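(* Let $1<p<\infty$. A Banach space $X$ has the $DPP_{p}$ if and only if each relatively weakly compact subset of $X^{*}$ is weakly $p$-limited.
   Context: Banach spaces are real or complex; an operator is a continuous linear map; $B_{X^{*}}$ is the closed unit ball of $X^{*}$. A sequence $(x_n)_n$ in $X$ is weakly $p$-summable, written $(x_n)_n\in l_p^w(X)$, if $\sup\{(\sum_{n=1}^{\infty}|\langle x^*,x_n\rangle|^p)^{1/p}:x^*\in B_{X^*}\}<\infty$; it is unconditionally $p$-summable, written $(x_n)_n\in l_p^u(X)$, if moreover $\sup\{(\sum_{n=m}^{\infty}|\langle x^*,x_n\rangle|^p)^{1/p}:x^*\in B_{X^*}\}\to 0$ as $m\to\infty$. An operator $T:X\to Y$ is unconditionally $p$-converging if $(Tx_n)_n\in l_p^u(Y)$ for every $(x_n)_n\in l_p^w(X)$. An operator $T:X\to Y$ is weakly compact if $T(B_X)$ is relatively weakly compact in $Y$. $X$ has the Dunford-Pettis property of order $p$ ($DPP_p$) if for every Banach space $Y$, every weakly compact operator $T:X\to Y$ is unconditionally $p$-converging. A bounded subset $K$ of $X^*$ is weakly $p$-limited if $\lim_{n\to\infty}\sup_{x^*\in K}|\langle x^*,x_n\rangle|=0$ for every $(x_n)_n\in l_p^w(X)$. *)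

theory Defs
  imports "HOL-Analysis.Analysis"
begin

section \<open>Normed spaces with an explicit carrier\<close>

text \<open>
  The Dunford-Pettis property of order p quantifies over all Banach spaces Y \<^emph>\<open>inside\<close> a definition,
  and HOL has no quantification over types inside a formula. Also, the type classes cover real scalars
  only. Hence a normed space is a record: a carrier set inside a type and the operations,
  over a scalar field \<open>'k\<close>, which will be \<open>real\<close> or \<open>complex\<close>.
\<close>

record ('k, 'a) nspace =
  carr :: "'a set"
  add :: "'a \<Rightarrow> 'a \<Rightarrow> 'a"
  zero :: "'a"
  smul :: "'k \<Rightarrow> 'a \<Rightarrow> 'a"
  nrm :: "'a \<Rightarrow> real"

locale normed_space =
  fixes X :: "('k::real_normed_field, 'a) nspace"
  assumes zero_closed: "zero X \<in> carr X"
    and add_closed: "\<lbrakk>x \<in> carr X; y \<in> carr X\<rbrakk> \<Longrightarrow> add X x y \<in> carr X"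
    and smul_closed: "x \<in> carr X \<Longrightarrow> smul X c x \<in> carr X"
    and add_assoc: "\<lbrakk>x \<in> carr X; y \<in> carr X; z \<in> carr X\<rbrakk>
          \<Longrightarrow> add X (add X x y) z = add X x (add X y z)"
    and add_commute: "\<lbrakk>x \<in> carr X; y \<in> carr X\<rbrakk> \<Longrightarrow> add X x y = add X y x"
    and add_zero: "x \<in> carr X \<Longrightarrow> add X x (zero X) = x"
    and add_inverse: "x \<in> carr X \<Longrightarrow> \<exists>y\<in>carr X. add X x y = zero X"
    and smul_add_right: "\<lbrakk>x \<in> carr X; y \<in> carr X\<rbrakk>
          \<Longrightarrow> smul X c (add X x y) = add X (smul X c x) (smul X c y)"
    and smul_add_left: "x \<in> carr X \<Longrightarrow> smul X (c + d) x = add X (smul X c x) (smul X d x)"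
    and smul_smul: "x \<in> carr X \<Longrightarrow> smul X c (smul X d x) = smul X (c * d) x"
    and smul_one: "x \<in> carr X \<Longrightarrow> smul X 1 x = x"
    and nrm_nonneg: "x \<in> carr X \<Longrightarrow> 0 \<le> nrm X x"
    and nrm_eq_0: "x \<in> carr X \<Longrightarrow> nrm X x = 0 \<longleftrightarrow> x = zero X"
    and nrm_triangle: "\<lbrakk>x \<in> carr X; y \<in> carr X\<rbrakk> \<Longrightarrow> nrm X (add X x y) \<le> nrm X x + nrm X y"
    and nrm_smul: "x \<in> carr X \<Longrightarrow> nrm X (smul X c x) = norm c * nrm X x"

text \<open>
  The value 0 outside the carrier is a dummy: the locale \<open>Metric_space\<close> demands a nonnegative
  and symmetric distance on the whole type.
\<close>

definition ndist :: "('k::real_normed_field, 'a) nspace \<Rightarrow> 'a \<Rightarrow> 'a \<Rightarrow> real" where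
  "ndist X x y = (if x \<in> carr X \<and> y \<in> carr X then nrm X (add X x (smul X (- 1) y)) else 0)"

definition norm_topology :: "('k::real_normed_field, 'a) nspace \<Rightarrow> 'a topology" where
  "norm_topology X = Metric_space.mtopology (carr X) (ndist X)"

definition banach_space :: "('k::real_normed_field, 'a) nspace \<Rightarrow> bool" where
  "banach_space X \<longleftrightarrow> normed_space X \<and> Metric_space.mcomplete (carr X) (ndist X)"

definition unit_ball :: "('k, 'a) nspace \<Rightarrow> 'a set" where
  "unit_ball X = {x \<in> carr X. nrm X x \<le> 1}"

definition operator ::
  "('k::real_normed_field, 'a) nspace \<Rightarrow> ('k, 'b) nspace \<Rightarrow> ('a \<Rightarrow> 'b) \<Rightarrow> bool" where
  "operator X Y T \<longleftrightarrow>
     T \<in> carr X \<rightarrow> carr Y \<and>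
     (\<forall>x\<in>carr X. \<forall>y\<in>carr X. T (add X x y) = add Y (T x) (T y)) \<and>
     (\<forall>c. \<forall>x\<in>carr X. T (smul X c x) = smul Y c (T x)) \<and>
     continuous_map (norm_topology X) (norm_topology Y) T"


section \<open>Dual space and weak topology\<close>

definition scalars :: "('k::real_normed_field, 'k) nspace" where
  "scalars = \<lparr>carr = UNIV, add = (+), zero = 0, smul = (*), nrm = norm\<rparr>"

text \<open>Functionals are extensional, so that functionals agreeing on the carrier are equal.\<close>

definition dual :: "('k::real_normed_field, 'a) nspace \<Rightarrow> ('k, 'a \<Rightarrow> 'k) nspace" where
  "dual X =
    \<lparr>carr = {f \<in> extensional (carr X). operator X scalars f},
     add = (\<lambda>f g. \<lambda>x\<in>carr X. f x + g x),
     zero = (\<lambda>x\<in>carr X. 0),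
     smul = (\<lambda>c f. \<lambda>x\<in>carr X. c * f x),
     nrm = (\<lambda>f. SUP x\<in>unit_ball X. norm (f x))\<rparr>"

definition weak_topology :: "('k::real_normed_field, 'a) nspace \<Rightarrow> 'a topology" where
  "weak_topology X =
     topology_generated_by {{x \<in> carr X. f x \<in> U} | f U. f \<in> carr (dual X) \<and> open U}"

definition relatively_weakly_compact :: "('k::real_normed_field, 'a) nspace \<Rightarrow> 'a set \<Rightarrow> bool" where
  "relatively_weakly_compact X S \<longleftrightarrow>
     S \<subseteq> carr X \<and> compactin (weak_topology X) (weak_topology X closure_of S)"

definition weakly_compact_operator ::
  "('k::real_normed_field, 'a) nspace \<Rightarrow> ('k, 'b) nspace \<Rightarrow> ('a \<Rightarrow> 'b) \<Rightarrow> bool" where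
  "weakly_compact_operator X Y T \<longleftrightarrow>
     operator X Y T \<and> relatively_weakly_compact Y (T ` unit_ball X)"


section \<open>Weakly and unconditionally p-summable sequences\<close>

definition tail_norm :: "real \<Rightarrow> (nat \<Rightarrow> 'k::real_normed_field) \<Rightarrow> nat \<Rightarrow> real" where
  "tail_norm p a m = (\<Sum>n. norm (a (n + m)) powr p) powr (1 / p)"

text \<open>
  A real supremum is finite iff all the series converge and the set of values is bounded.
\<close>

definition weakly_summable ::
  "real \<Rightarrow> ('k::real_normed_field, 'a) nspace \<Rightarrow> (nat \<Rightarrow> 'a) set" where
  "weakly_summable p X =
     {x. range x \<subseteq> carr X \<and>
         (\<forall>f\<in>unit_ball (dual X). summable (\<lambda>n. norm (f (x n)) powr p)) \<and>
         bdd_above ((\<lambda>f. tail_norm p (\<lambda>n. f (x n)) 0) ` unit_ball (dual X))}"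

definition unconditionally_summable ::
  "real \<Rightarrow> ('k::real_normed_field, 'a) nspace \<Rightarrow> (nat \<Rightarrow> 'a) set" where
  "unconditionally_summable p X =
     {x \<in> weakly_summable p X.
        (\<lambda>m. SUP f\<in>unit_ball (dual X). tail_norm p (\<lambda>n. f (x n)) m) \<longlonglongrightarrow> 0}"

definition unconditionally_converging ::
  "real \<Rightarrow> ('k::real_normed_field, 'a) nspace \<Rightarrow> ('k, 'b) nspace \<Rightarrow> ('a \<Rightarrow> 'b) \<Rightarrow> bool" where
  "unconditionally_converging p X Y T \<longleftrightarrow>
     operator X Y T \<and>
     (\<forall>x\<in>weakly_summable p X. (\<lambda>n. T (x n)) \<in> unconditionally_summable p Y)"


section \<open>The Dunford-Pettis property of order p and weakly p-limited sets\<close>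

text \<open>
  Here Y ranges over all Banach spaces whose carrier is a subset of the universe \<open>'u\<close>. A theorem
  with \<open>'u\<close> as a type variable speaks about every universe, in particular one that contains
  a copy of any given Banach space.
\<close>

definition DPP ::
  "'u itself \<Rightarrow> real \<Rightarrow> ('k::real_normed_field, 'a) nspace \<Rightarrow> bool" where
  "DPP _ p X \<longleftrightarrow>
     (\<forall>(Y :: ('k, 'u) nspace) T.
        banach_space Y \<longrightarrow> weakly_compact_operator X Y T \<longrightarrow> unconditionally_converging p X Y T)"

text \<open>
  The supremum is taken in \<open>ennreal\<close>, where it is 0 for empty K; the real supremum of the empty
  set is an unspecified number.
\<close>

definition weakly_limited ::
  "real \<Rightarrow> ('k::real_normed_field, 'a) nspace \<Rightarrow> ('a \<Rightarrow> 'k) set \<Rightarrow> bool" where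
  "weakly_limited p X K \<longleftrightarrow>
     K \<subseteq> carr (dual X) \<and> (\<exists>C. \<forall>f\<in>K. nrm (dual X) f \<le> C) \<and>
     (\<forall>x\<in>weakly_summable p X. (\<lambda>n. SUP f\<in>K. ennreal (norm (f (x n)))) \<longlonglongrightarrow> 0)"


section \<open>Basic facts\<close>

lemma (in normed_space) smul_0: assumes x: "x \<in> carr X" shows "smul X 0 x = zero X"
proof -
  have "nrm X (smul X 0 x) = 0" using nrm_smul[OF x, of 0] by simp
  then show ?thesis using nrm_eq_0 smul_closed x by blast
qed

lemma (in normed_space) add_minus:
  assumes x: "x \<in> carr X" shows "add X x (smul X (- 1) x) = zero X"
  using smul_add_left[OF x, of 1 "- 1"] by (simp add: smul_0 smul_one x)

lemma (in normed_space) Metric_space_ndist: "Metric_space (carr X) (ndist X)"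
proof
  show "0 \<le> ndist X x y" for x y
    by (simp add: ndist_def nrm_nonneg add_closed smul_closed)
  show "ndist X x y = ndist X y x" for x y
  proof (cases "x \<in> carr X \<and> y \<in> carr X")
    case True
    then have "add X y (smul X (- 1) x) = smul X (- 1) (add X x (smul X (- 1) y))"
      by (simp add: smul_add_right smul_closed smul_smul smul_one add_commute)
    with True show ?thesis
      by (simp add: ndist_def nrm_smul add_closed smul_closed)
  qed (auto simp: ndist_def)
  show "ndist X x y = 0 \<longleftrightarrow> x = y" if x: "x \<in> carr X" and y: "y \<in> carr X" for x y
  proof
    assume "ndist X x y = 0"
    then have *: "add X x (smul X (- 1) y) = zero X"
      using x y by (simp add: ndist_def nrm_eq_0 add_closed smul_closed)
    have "x = add X x (add X (smul X (- 1) y) y)"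
      using add_minus[OF y] x y by (simp add: add_commute smul_closed add_zero)
    also have "\<dots> = add X (zero X) y"
      using x y * by (simp add: add_assoc[symmetric] smul_closed)
    also have "\<dots> = y" using y by (metis add_commute zero_closed add_zero)
    finally show "x = y" .
  next
    assume "x = y"
    then show "ndist X x y = 0"
      using x by (simp add: ndist_def add_minus nrm_eq_0 zero_closed)
  qed
  show "ndist X x z \<le> ndist X x y + ndist X y z"
    if x: "x \<in> carr X" and y: "y \<in> carr X" and z: "z \<in> carr X" for x y z
  proof -
    let ?m = "smul X (- 1)"
    have m: "?m y \<in> carr X" "?m z \<in> carr X" using y z by (auto simp: smul_closed)
    have "add X (add X x (?m y)) (add X y (?m z)) = add X x (add X (add X (?m y) y) (?m z))"
      using x y m by (simp add: add_assoc add_closed)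
    also have "add X (?m y) y = zero X" using add_minus[OF y] y m by (metis add_commute)
    also have "add X (zero X) (?m z) = ?m z" using m by (metis add_commute zero_closed add_zero)
    finally show ?thesis
      using nrm_triangle[of "add X x (?m y)" "add X y (?m z)"] x y z m
      by (simp add: ndist_def add_closed)
  qed
qed

lemma normed_space_scalars: "normed_space (scalars :: ('k::real_normed_field, 'k) nspace)"
proof (unfold_locales, goal_cases)
  case (7 x) show ?case by (auto simp: scalars_def intro: exI[of _ "- x"])
qed (auto simp: scalars_def algebra_simps norm_mult norm_triangle_ineq)

lemma norm_topology_scalars: "norm_topology (scalars :: ('k::real_normed_field, 'k) nspace) = euclidean"
proof -
  have "ndist (scalars :: ('k, 'k) nspace) = dist"
    by (intro ext) (simp add: ndist_def scalars_def dist_norm)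
  then show ?thesis by (simp add: norm_topology_def scalars_def)
qed

lemma (in normed_space) topspace_weak_topology: "topspace (weak_topology X) = carr X"
proof -
  interpret Metric_space "carr X" "ndist X" by (rule Metric_space_ndist)
  have "topspace (norm_topology X) = carr X" by (simp add: norm_topology_def)
  then have "(\<lambda>x\<in>carr X. 0) \<in> carr (dual X)"
    by (auto simp: dual_def operator_def norm_topology_scalars add_closed smul_closed)
       (auto simp: scalars_def intro!: continuous_map_eq[of _ _ "\<lambda>_. 0"])
  then show ?thesis
    unfolding weak_topology_def topology_generated_by_topspace by blast
qed

end

theory Submission
  imports Defs "HOL-Complex_Analysis.Great_Picard"
begin

text \<open>
  Both directions translate between an operator \<open>T : X \<rightarrow> Y\<close> and the set \<open>T\<^sup>*(B)\<close> of functionals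
  \<open>g \<circ> T\<close>, where \<open>g\<close> runs through the dual unit ball \<open>B\<close> of \<open>Y\<close>.

  \<^emph>\<open>From limited sets to the Dunford-Pettis property.\<close> If \<open>T\<close> is weakly compact, then \<open>T\<^sup>*(B)\<close>
  is relatively weakly compact in the dual of \<open>X\<close> (Gantmacher,
  \<open>adjoint_relatively_weakly_compact\<close>): \<open>T\<close> maps the bidual of \<open>X\<close> into \<open>Y\<close>, hence \<open>T\<^sup>*\<close> is
  continuous from the topology of pointwise convergence to the weak topology, and \<open>B\<close> is compact for
  the former. So \<open>T\<^sup>*(B)\<close> is weakly p-limited, which says that \<open>T z\<^sub>k\<close> tends to 0 uniformly on
  \<open>B\<close> for every weakly p-summable \<open>z\<close>. This already forces \<open>T\<close> to be unconditionally p-converging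
  (\<open>unconditionally_convergingI\<close>): if the tails of \<open>T x\<^sub>n\<close> did not become small, the extremal
  coefficients in Hoelder's inequality would give blocks \<open>z\<^sub>k = \<Sum> a\<^sub>i x\<^sub>i\<close> that are again weakly
  p-summable although \<open>T z\<^sub>k\<close> stays away from 0.

  \<^emph>\<open>From the Dunford-Pettis property to limited sets.\<close> Let \<open>K\<close> be relatively weakly compact in the
  dual of \<open>X\<close>. It is bounded by the uniform boundedness principle. If it is not weakly p-limited,
  there are functionals \<open>f\<^sub>k \<in> K\<close> and indices \<open>\<nu> k\<close>, increasing with \<open>k\<close>, such that
  \<open>f\<^sub>k (x (\<nu> k))\<close> stays away from 0.
  By the Eberlein-Smulian theorem (\<open>eberlein_smulian_dual\<close>) one may assume that \<open>f\<^sub>k\<close> converges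
  weakly to some \<open>g\<close>. Then \<open>x \<mapsto> ((f\<^sub>k - g) x)\<^sub>k\<close> is a weakly compact operator into \<open>c\<^sub>0\<close>
  (\<open>weakly_null_functionals_operator\<close>), hence unconditionally p-converging, so \<open>(f\<^sub>k - g) x\<^sub>n\<close>
  tends to 0 as \<open>n\<close> grows, uniformly in \<open>k\<close>. Since \<open>g x\<^sub>n\<close> tends to 0 as well, this is a
  contradiction. The target space \<open>c\<^sub>0\<close> has the cardinality of the continuum, which is why every
  universe of at least that cardinality suffices.

  The functional analysis rests on one finite-dimensional fact, Helly's lemma (\<open>helly\<close>): a
  functional on the dual of \<open>X\<close> of norm at most 1 agrees, on finitely many elements and up to
  \<open>\<epsilon>\<close>, with the evaluation at some point of the unit ball of \<open>X\<close>. Together with the compactness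
  of dual balls it takes the place of the Hahn-Banach theorem throughout.

  Real and complex scalars are treated together as fields \<open>'k\<close> with a multiplicative norm that
  comes from an inner product. There \<open>z \<bullet> 1\<close> is the real part of \<open>z\<close>, and
  \<open>of_real ((norm u)\<^sup>2) / u\<close> is the conjugate of \<open>u\<close>.
\<close>

section \<open>Bounded operators and the dual norm\<close>

text \<open>
  Continuity at 0 bounds the operator on a small ball, hence everywhere by homogeneity; conversely
  a bounded linear map is Lipschitz. Taking the scalars as target space, this describes the dual
  without reference to a topology.
\<close>

lemma operator_iff_bounded:
  assumes X: "normed_space X" and Y: "normed_space Y"
  shows "operator X Y T \<longleftrightarrow>
    T \<in> carr X \<rightarrow> carr Y \<and>
    (\<forall>x\<in>carr X. \<forall>y\<in>carr X. T (add X x y) = add Y (T x) (T y)) \<and>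
    (\<forall>c. \<forall>x\<in>carr X. T (smul X c x) = smul Y c (T x)) \<and>
    (\<exists>C. \<forall>x\<in>carr X. nrm Y (T x) \<le> C * nrm X x)"
    (is "_ \<longleftrightarrow> ?into \<and> ?additive \<and> ?homogeneous \<and> ?bounded")
proof -
  interpret X: normed_space X by fact
  interpret Y: normed_space Y by fact
  interpret MX: Metric_space "carr X" "ndist X" by (rule X.Metric_space_ndist)
  interpret MY: Metric_space "carr Y" "ndist Y" by (rule Y.Metric_space_ndist)
  have continuous_iff: "continuous_map (norm_topology X) (norm_topology Y) T \<longleftrightarrow> ?bounded"
    if into: ?into and additive: ?additive and homogeneous: ?homogeneous
  proof -
    have cont_iff: "continuous_map (norm_topology X) (norm_topology Y) T \<longleftrightarrow>
        (\<forall>a\<in>carr X. \<forall>\<epsilon>>0. \<exists>\<delta>>0. \<forall>x. x \<in> carr X \<and> ndist X a x < \<delta> \<longrightarrow> ndist Y (T a) (T x) < \<epsilon>)"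
      using into unfolding norm_topology_def MX.metric_continuous_map[OF MY.Metric_space_axioms]
      by auto
    have Tzero: "T (zero X) = zero Y"
      using homogeneous X.zero_closed X.smul_0 Y.smul_0 into by (metis Pi_mem)
    have dist_zero_X: "ndist X (zero X) x = nrm X x" if "x \<in> carr X" for x
    proof -
      have "ndist X (zero X) x = ndist X x (zero X)" by (rule MX.commute)
      also have "\<dots> = nrm X (add X x (smul X 0 (zero X)))"
        using that X.zero_closed X.smul_smul[of "zero X" "-1" 0] X.smul_0[of "zero X"]
        by (simp add: ndist_def)
      finally show ?thesis using that by (simp add: X.smul_0 X.zero_closed X.add_zero)
    qed
    have dist_zero_Y: "ndist Y (zero Y) x = nrm Y x" if "x \<in> carr Y" for x
    proof -
      have "ndist Y (zero Y) x = ndist Y x (zero Y)" by (rule MY.commute)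
      also have "\<dots> = nrm Y (add Y x (smul Y 0 (zero Y)))"
        using that Y.zero_closed Y.smul_smul[of "zero Y" "-1" 0] Y.smul_0[of "zero Y"]
        by (simp add: ndist_def)
      finally show ?thesis using that by (simp add: Y.smul_0 Y.zero_closed Y.add_zero)
    qed
    show ?thesis
    proof
      assume "continuous_map (norm_topology X) (norm_topology Y) T"
      then obtain \<delta> where \<delta>: "\<delta> > 0"
        and near: "\<And>x. x \<in> carr X \<and> ndist X (zero X) x < \<delta> \<Longrightarrow> ndist Y (T (zero X)) (T x) < 1"
        unfolding cont_iff using X.zero_closed zero_less_one by blast
      have small: "nrm Y (T x) < 1" if "x \<in> carr X" "nrm X x < \<delta>" for x
        using near[of x] that into by (auto simp: dist_zero_X dist_zero_Y Tzero Pi_iff)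
      have "nrm Y (T x) \<le> (2 / \<delta>) * nrm X x" if x: "x \<in> carr X" for x
      proof (cases "nrm X x = 0")
        case True
        then have "T x = zero Y" using x X.nrm_eq_0 Tzero by auto
        then show ?thesis using True Y.nrm_eq_0[OF Y.zero_closed] by simp
      next
        case False
        then have pos: "nrm X x > 0" using X.nrm_nonneg[OF x] by linarith
        let ?c = "of_real (\<delta> / 2 / nrm X x)"
        have "nrm Y (T (smul X ?c x)) < 1"
          using \<delta> pos x
          by (intro small) (simp_all add: X.smul_closed X.nrm_smul norm_divide)
        moreover have "nrm Y (T (smul X ?c x)) = \<delta> / 2 / nrm X x * nrm Y (T x)"
          using \<delta> pos homogeneous x into by (subst homogeneous[rule_format, OF x], subst Y.nrm_smul) (auto simp: norm_divide)
        ultimately have "\<delta> / 2 / nrm X x * nrm Y (T x) < 1" by metis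
        then show ?thesis using pos \<delta> by (simp add: field_simps)
      qed
      then show ?bounded by blast
    next
      assume ?bounded
      then obtain C where C: "\<And>x. x \<in> carr X \<Longrightarrow> nrm Y (T x) \<le> C * nrm X x" by blast
      have lip: "ndist Y (T a) (T x) \<le> \<bar>C\<bar> * ndist X a x" if a: "a \<in> carr X" and x: "x \<in> carr X" for a x
      proof -
        let ?z = "add X a (smul X (-1) x)"
        have z: "?z \<in> carr X" using a x by (simp add: X.add_closed X.smul_closed)
        have "T ?z = add Y (T a) (smul Y (-1) (T x))"
          using additive homogeneous a x X.smul_closed by simp
        then have dists: "ndist Y (T a) (T x) = nrm Y (T ?z)" "ndist X a x = nrm X ?z"
          using a x into by (auto simp: ndist_def)
        have "C * nrm X ?z \<le> \<bar>C\<bar> * nrm X ?z"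
          using X.nrm_nonneg[OF z] by (intro mult_right_mono) auto
        with C[OF z] show ?thesis unfolding dists by (rule order_trans)
      qed
      show "continuous_map (norm_topology X) (norm_topology Y) T"
        unfolding cont_iff
      proof (intro ballI allI impI)
        fix a and \<epsilon> :: real assume a: "a \<in> carr X" and \<epsilon>: "\<epsilon> > 0"
        have "ndist Y (T a) (T x) < \<epsilon>" if "x \<in> carr X" "ndist X a x < \<epsilon> / (\<bar>C\<bar> + 1)" for x
        proof -
          have "\<bar>C\<bar> * ndist X a x \<le> (\<bar>C\<bar> + 1) * ndist X a x"
            by (intro mult_right_mono) auto
          also have "\<dots> < \<epsilon>" using that by (simp add: field_simps)
          finally show ?thesis using lip[OF a that(1)] by linarith
        qed
        then show "\<exists>\<delta>>0. \<forall>x. x \<in> carr X \<and> ndist X a x < \<delta> \<longrightarrow> ndist Y (T a) (T x) < \<epsilon>"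
          using \<epsilon> by (intro exI[of _ "\<epsilon> / (\<bar>C\<bar> + 1)"]) auto
      qed
    qed
  qed
  show ?thesis unfolding operator_def by (intro conj_cong refl continuous_iff)
qed

lemma in_dual_iff:
  assumes "normed_space X"
  shows "f \<in> carr (dual X) \<longleftrightarrow>
    f \<in> extensional (carr X) \<and>
    (\<forall>x\<in>carr X. \<forall>y\<in>carr X. f (add X x y) = f x + f y) \<and>
    (\<forall>c. \<forall>x\<in>carr X. f (smul X c x) = c * f x) \<and>
    (\<exists>C. \<forall>x\<in>carr X. norm (f x) \<le> C * nrm X x)"
  by (simp add: dual_def operator_iff_bounded[OF assms normed_space_scalars]) (simp add: scalars_def)

lemma zero_in_unit_ball: "normed_space X \<Longrightarrow> zero X \<in> unit_ball X"
  using normed_space.nrm_eq_0 normed_space.zero_closed by (fastforce simp: unit_ball_def)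

lemma dual_apply_le_unit_ball:
  assumes X: "normed_space X" and f: "f \<in> carr (dual X)" and x: "x \<in> unit_ball X"
  shows "norm (f x) \<le> nrm (dual X) f"
proof -
  obtain C where C: "\<And>x. x \<in> carr X \<Longrightarrow> norm (f x) \<le> C * nrm X x"
    using f unfolding in_dual_iff[OF X] by blast
  have "norm (f y) \<le> \<bar>C\<bar>" if "y \<in> unit_ball X" for y
  proof -
    have "C * nrm X y \<le> \<bar>C\<bar> * 1"
      using that normed_space.nrm_nonneg[OF X] by (intro mult_mono) (auto simp: unit_ball_def)
    then show ?thesis using C[of y] that by (auto simp: unit_ball_def)
  qed
  then have "bdd_above ((\<lambda>y. norm (f y)) ` unit_ball X)" by (rule bdd_aboveI2)
  from cSUP_upper[OF x this] show ?thesis by (simp add: dual_def)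
qed

lemma dual_apply_le:
  assumes X: "normed_space X" and f: "f \<in> carr (dual X)" and x: "x \<in> carr X"
  shows "norm (f x) \<le> nrm (dual X) f * nrm X x"
proof (cases "nrm X x = 0")
  case True
  then show ?thesis using f x unfolding in_dual_iff[OF X] by fastforce
next
  case False
  interpret normed_space X by fact
  have pos: "nrm X x > 0" using False nrm_nonneg[OF x] by linarith
  let ?y = "smul X (of_real (1 / nrm X x)) x"
  have "?y \<in> unit_ball X" using x pos by (simp add: unit_ball_def smul_closed nrm_smul norm_divide)
  then have "norm (f ?y) \<le> nrm (dual X) f" by (rule dual_apply_le_unit_ball[OF X f])
  moreover have "f ?y = of_real (1 / nrm X x) * f x" using f x by (simp add: in_dual_iff[OF X])
  ultimately have "norm (f x) / nrm X x \<le> nrm (dual X) f"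
    using pos by (simp only: norm_mult norm_of_real) simp
  then show ?thesis using pos by (simp add: field_simps)
qed

lemma dual_nrm_le:
  assumes "normed_space X" and "\<And>x. x \<in> unit_ball X \<Longrightarrow> norm (f x) \<le> C"
  shows "nrm (dual X) f \<le> C"
  using assms zero_in_unit_ball by (auto simp: dual_def intro!: cSUP_least)

lemma dual_nrm_nonneg:
  assumes "normed_space X" and "f \<in> carr (dual X)"
  shows "0 \<le> nrm (dual X) f"
  using dual_apply_le_unit_ball[OF assms zero_in_unit_ball[OF assms(1)]] norm_ge_zero order_trans by blast

lemma dualI:
  assumes "normed_space X"
    and "\<And>x y. x \<in> carr X \<Longrightarrow> y \<in> carr X \<Longrightarrow> f (add X x y) = f x + f y"
    and "\<And>c x. x \<in> carr X \<Longrightarrow> f (smul X c x) = c * f x"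
    and "\<And>x. x \<in> carr X \<Longrightarrow> norm (f x) \<le> C * nrm X x"
  shows "(\<lambda>x\<in>carr X. f x) \<in> carr (dual X)"
  unfolding in_dual_iff[OF assms(1)]
proof (intro conjI exI[of _ C])
qed (use assms in \<open>auto simp: normed_space.add_closed normed_space.smul_closed\<close>)

lemma dual_linear:
  assumes "normed_space X" and "f \<in> carr (dual X)"
  shows "x \<in> carr X \<Longrightarrow> y \<in> carr X \<Longrightarrow> f (add X x y) = f x + f y"
    and "x \<in> carr X \<Longrightarrow> f (smul X c x) = c * f x"
  using assms by (simp_all add: in_dual_iff)

lemma dual_ext:
  assumes "normed_space X" "f \<in> carr (dual X)" "g \<in> carr (dual X)" "\<And>x. x \<in> carr X \<Longrightarrow> f x = g x"
  shows "f = g"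
  using assms by (auto simp: in_dual_iff intro: extensionalityI)

lemma dual_simps:
  "x \<in> carr X \<Longrightarrow> add (dual X) f g x = f x + g x"
  "x \<in> carr X \<Longrightarrow> smul (dual X) c f x = c * f x"
  "x \<in> carr X \<Longrightarrow> zero (dual X) x = 0"
  by (simp_all add: dual_def)

lemma normed_space_dual:
  assumes X: "normed_space X"
  shows "normed_space (dual X)"
proof -
  interpret normed_space X by fact
  have zero: "zero (dual X) \<in> carr (dual X)"
    using dualI[OF X, of "\<lambda>_. 0" 0] by (simp add: dual_def)
  have add: "add (dual X) f g \<in> carr (dual X)"
    if f: "f \<in> carr (dual X)" and g: "g \<in> carr (dual X)" for f g
  proof -
    have "norm (f x + g x) \<le> (nrm (dual X) f + nrm (dual X) g) * nrm X x" if "x \<in> carr X" for x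
      using dual_apply_le[OF X f that] dual_apply_le[OF X g that] norm_triangle_ineq[of "f x" "g x"]
      by (simp add: algebra_simps)
    moreover have "add (dual X) f g = (\<lambda>x\<in>carr X. f x + g x)" by (simp add: dual_def)
    ultimately show ?thesis
      by (auto simp: dual_linear[OF X f] dual_linear[OF X g] algebra_simps simp del: restrict_apply
          intro!: dualI[OF X, where C="nrm (dual X) f + nrm (dual X) g"])
  qed
  have smul: "smul (dual X) c f \<in> carr (dual X)" if f: "f \<in> carr (dual X)" for f c
  proof -
    have "norm (c * f x) \<le> (norm c * nrm (dual X) f) * nrm X x" if "x \<in> carr X" for x
      using mult_left_mono[OF dual_apply_le[OF X f that], of "norm c"]
      by (simp add: algebra_simps norm_mult)
    moreover have "smul (dual X) c f = (\<lambda>x\<in>carr X. c * f x)" by (simp add: dual_def)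
    ultimately show ?thesis
      by (auto simp: dual_linear[OF X f] algebra_simps simp del: restrict_apply
          intro!: dualI[OF X, where C="norm c * nrm (dual X) f"])
  qed
  have carrier: "unit_ball X \<subseteq> carr X" by (auto simp: unit_ball_def)
  have nrm_smul_le: "nrm (dual X) (smul (dual X) c f) \<le> norm c * nrm (dual X) f"
    if f: "f \<in> carr (dual X)" for c f
    using carrier dual_apply_le_unit_ball[OF X f]
    by (intro dual_nrm_le[OF X]) (auto simp: dual_simps norm_mult subset_iff intro!: mult_left_mono)
  show ?thesis
  proof
    show "nrm (dual X) (smul (dual X) c f) = norm c * nrm (dual X) f" if f: "f \<in> carr (dual X)" for c f
    proof (cases "c = 0")
      case True
      then show ?thesis using nrm_smul_le[OF f, of c] dual_nrm_nonneg[OF X smul[OF f, of c]] by simp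
    next
      case False
      have "smul (dual X) (1 / c) (smul (dual X) c f) = f"
        using False by (intro dual_ext[OF X smul[OF smul[OF f]] f]) (simp add: dual_simps)
      then have "nrm (dual X) f \<le> norm (1 / c) * nrm (dual X) (smul (dual X) c f)"
        using nrm_smul_le[OF smul[OF f], of "1 / c"] by metis
      then show ?thesis using False nrm_smul_le[OF f, of c] by (simp add: norm_divide field_simps)
    qed
    show "\<exists>g\<in>carr (dual X). add (dual X) f g = zero (dual X)" if f: "f \<in> carr (dual X)" for f
      by (intro bexI[of _ "smul (dual X) (-1) f"] dual_ext[OF X add[OF f smul] zero])
        (auto simp: dual_simps f smul)
    show "nrm (dual X) f = 0 \<longleftrightarrow> f = zero (dual X)" if f: "f \<in> carr (dual X)" for f
    proof
      assume "nrm (dual X) f = 0"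
      then show "f = zero (dual X)"
        using dual_apply_le[OF X f] by (intro dual_ext[OF X f zero]) (auto simp: dual_simps)
    next
      assume "f = zero (dual X)"
      then have "nrm (dual X) f \<le> 0" using carrier by (intro dual_nrm_le[OF X]) (auto simp: dual_simps)
      then show "nrm (dual X) f = 0" using dual_nrm_nonneg[OF X f] by simp
    qed
    show "nrm (dual X) (add (dual X) f g) \<le> nrm (dual X) f + nrm (dual X) g"
      if f: "f \<in> carr (dual X)" and g: "g \<in> carr (dual X)" for f g
    proof (rule dual_nrm_le[OF X])
      fix x assume x: "x \<in> unit_ball X"
      then show "norm (add (dual X) f g x) \<le> nrm (dual X) f + nrm (dual X) g"
        using dual_apply_le_unit_ball[OF X f x] dual_apply_le_unit_ball[OF X g x] carrier
          norm_triangle_ineq[of "f x" "g x"] by (auto simp: dual_simps)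
    qed
  show "\<And>f. f \<in> carr (dual X) \<Longrightarrow> 0 \<le> nrm (dual X) f" by (rule dual_nrm_nonneg[OF X])
    show "zero (dual X) \<in> carr (dual X)" by (rule zero)
  qed ((rule add smul dual_ext[OF X]; auto simp: zero add smul dual_simps algebra_simps)+)
qed

section \<open>Compactness\<close>

text \<open>
  Cluster points are taken along a finer filter, so that afterwards they can be treated as ordinary
  limits: all continuous functions converge along the same filter \<open>G\<close>. If no point of \<open>K\<close> had such a
  filter, each would have a neighbourhood that \<open>s\<close> eventually avoids, and finitely many of these
  would cover \<open>K\<close>.
\<close>

lemma compactin_cluster_point:
  assumes K: "compactin X K" and F: "F \<noteq> bot" and ev: "eventually (\<lambda>i. s i \<in> K) F"
  obtains l G where "l \<in> K" "G \<le> F" "G \<noteq> bot" "limitin X s l G"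
proof -
  let ?G = "\<lambda>l. inf F (filtercomap s (nhdsin X l))"
  have top: "K \<subseteq> topspace X" using K by (rule compactin_subset_topspace)
  have "\<exists>l\<in>K. ?G l \<noteq> bot"
  proof (rule ccontr)
    assume "\<not> (\<exists>l\<in>K. ?G l \<noteq> bot)"
    then have bot: "\<And>l. l \<in> K \<Longrightarrow> ?G l = bot" by blast
    let ?\<U> = "{U. openin X U \<and> eventually (\<lambda>i. s i \<notin> U) F}"
    have "K \<subseteq> \<Union>?\<U>"
    proof
      fix l assume l: "l \<in> K"
      have "eventually (\<lambda>_. False) (?G l)" unfolding bot[OF l] by simp
      then obtain P Q where "eventually P F" and Q: "eventually Q (filtercomap s (nhdsin X l))"
        and PQ: "\<And>i. P i \<Longrightarrow> Q i \<Longrightarrow> False"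
        unfolding eventually_inf by blast
      obtain R where R: "eventually R (nhdsin X l)" and RQ: "\<And>i. R (s i) \<Longrightarrow> Q i"
        using Q unfolding eventually_filtercomap by blast
      obtain U where U: "openin X U" "l \<in> U" "\<And>x. x \<in> U \<Longrightarrow> R x"
        using R l top unfolding eventually_nhdsin by blast
      have "eventually (\<lambda>i. s i \<notin> U) F"
        using \<open>eventually P F\<close> by (rule eventually_mono) (use PQ RQ U in blast)
      then show "l \<in> \<Union>?\<U>" using U by blast
    qed
    then obtain \<V> where \<V>: "finite \<V>" "\<V> \<subseteq> ?\<U>" "K \<subseteq> \<Union>\<V>"
      using compactinD[OF K, of ?\<U>] by auto
    have "eventually (\<lambda>i. \<forall>U\<in>\<V>. s i \<notin> U) F"
      using \<V> by (intro eventually_ball_finite) auto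
    with ev have "eventually (\<lambda>i. False) F"
      by eventually_elim (use \<V> in blast)
    then show False using F by (simp add: trivial_limit_def)
  qed
  then obtain l where l: "l \<in> K" "?G l \<noteq> bot" by blast
  have "limitin X s l (?G l)"
    unfolding limitin_def
  proof (intro conjI allI impI)
    show "l \<in> topspace X" using l top by blast
    fix U assume U: "openin X U \<and> l \<in> U"
    then have "eventually (\<lambda>x. x \<in> U) (nhdsin X l)" by (auto simp: eventually_nhdsin)
    then have "eventually (\<lambda>i. s i \<in> U) (filtercomap s (nhdsin X l))"
      by (rule eventually_filtercomapI)
    then show "eventually (\<lambda>i. s i \<in> U) (?G l)" by (rule filter_leD[OF inf_le2])
  qed
  with l show thesis by (intro that[of l "?G l"]) auto
qed

text \<open>
  On the dual space this is the weak-* topology.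
\<close>

abbreviation pointwise_topology :: "('k::real_normed_field, 'a) nspace \<Rightarrow> ('a \<Rightarrow> 'k) topology" where
  "pointwise_topology X \<equiv> product_topology (\<lambda>_. euclidean) (carr X)"

lemma in_dual_unit_ball_iff:
  assumes X: "normed_space X"
  shows "f \<in> unit_ball (dual X) \<longleftrightarrow>
    f \<in> extensional (carr X) \<and>
    (\<forall>x\<in>carr X. \<forall>y\<in>carr X. f (add X x y) = f x + f y) \<and>
    (\<forall>c. \<forall>x\<in>carr X. f (smul X c x) = c * f x) \<and>
    (\<forall>x\<in>carr X. norm (f x) \<le> nrm X x)"
    (is "_ \<longleftrightarrow> ?rhs")
proof
  assume "f \<in> unit_ball (dual X)"
  then have f: "f \<in> carr (dual X)" "nrm (dual X) f \<le> 1" by (auto simp: unit_ball_def)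
  have "norm (f x) \<le> nrm X x" if x: "x \<in> carr X" for x
    using dual_apply_le[OF X f(1) x] mult_right_mono[OF f(2) normed_space.nrm_nonneg[OF X x]] by simp
  then show ?rhs using f(1) by (simp add: in_dual_iff[OF X])
next
  assume rhs: ?rhs
  then have "f \<in> carr (dual X)"
    unfolding in_dual_iff[OF X] by (intro conjI exI[of _ 1]) simp_all
  moreover have "nrm (dual X) f \<le> 1"
    using rhs by (intro dual_nrm_le[OF X]) (force simp: unit_ball_def)
  ultimately show "f \<in> unit_ball (dual X)" by (simp add: unit_ball_def)
qed

text \<open>
  Banach-Alaoglu: the unit ball is the part of a product of closed balls that is cut out by the
  equations of linearity, each of which involves at most three coordinates and is thus a closed
  condition.
\<close>

lemma compactin_dual_unit_ball:
  fixes X :: "('k::{real_normed_field,heine_borel}, 'a) nspace"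
  assumes X: "normed_space X"
  shows "compactin (pointwise_topology X) (unit_ball (dual X))"
proof -
  interpret normed_space X by fact
  let ?T = "pointwise_topology X"
  define P where "P = PiE (carr X) (\<lambda>x. cball (0::'k) (nrm X x))"
  define A where "A x y = {f \<in> topspace ?T. f (add X x y) - f x - f y \<in> {0}}" for x y
  define H where "H c x = {f \<in> topspace ?T. f (smul X c x) - c * f x \<in> {0}}" for c x
  let ?\<C> = "insert P ((\<lambda>(x, y). A x y) ` (carr X \<times> carr X) \<union> (\<lambda>(c, x). H c x) ` (UNIV \<times> carr X))"
  have proj: "continuous_map ?T euclidean (\<lambda>f. f x)" if "x \<in> carr X" for x
    by (rule continuous_map_product_projection[OF that])
  have A: "closedin ?T (A x y)" if "x \<in> carr X" "y \<in> carr X" for x y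
    unfolding A_def
    using that by (intro closedin_continuous_map_preimage[where Y=euclidean] continuous_map_diff proj add_closed) auto
  have H: "closedin ?T (H c x)" if "x \<in> carr X" for c x
  proof -
    have "continuous_map euclidean euclidean (\<lambda>z. c * z)"
      by (simp add: continuous_map_iff_continuous2 continuous_intros)
    from continuous_map_compose[OF proj[OF that] this]
    have "continuous_map ?T euclidean (\<lambda>f. c * f x)" by (simp add: o_def)
    then show ?thesis
      unfolding H_def
      using that by (intro closedin_continuous_map_preimage[where Y=euclidean] continuous_map_diff proj smul_closed) auto
  qed
  have P: "closedin ?T P" by (simp add: P_def closedin_product_topology)
  have "closedin ?T S" if "S \<in> ?\<C>" for S
    using that A H P by (elim insertE UnE imageE SigmaE) simp_all
  then have "closedin ?T (\<Inter>?\<C>)" by (rule closedin_Inter[OF insert_not_empty])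
  moreover have "compactin ?T P" by (simp add: P_def compactin_PiE)
  moreover have "\<Inter>?\<C> \<subseteq> P" by simp
  ultimately have "compactin ?T (\<Inter>?\<C>)" using closed_compactin by metis
  moreover have "f \<in> unit_ball (dual X) \<longleftrightarrow> f \<in> \<Inter>?\<C>" for f
  proof -
    have "f \<in> \<Inter>?\<C> \<longleftrightarrow> f \<in> P \<and> (\<forall>x\<in>carr X. \<forall>y\<in>carr X. f \<in> A x y) \<and> (\<forall>c. \<forall>x\<in>carr X. f \<in> H c x)"
      by auto
    also have "\<dots> \<longleftrightarrow> f \<in> unit_ball (dual X)"
      unfolding in_dual_unit_ball_iff[OF X]
      by (auto simp: P_def A_def H_def PiE_def Pi_def diff_diff_eq)
    finally show ?thesis by simp
  qed
  then have "unit_ball (dual X) = \<Inter>?\<C>" by blast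
  ultimately show ?thesis by simp
qed

section \<open>Helly's lemma and Goldstine's theorem\<close>

text \<open>
  Multiplication by \<open>c\<close> scales the norm by \<open>norm c\<close>, and by polarization the norm determines the
  inner product.
\<close>

lemma inner_mult_mult:
  fixes a b c :: "'k::{real_normed_field,real_inner}"
  shows "(c * a) \<bullet> (c * b) = (norm c)\<^sup>2 * (a \<bullet> b)"
proof -
  have "norm (c * a + c * b) = norm c * norm (a + b)"
    by (simp add: norm_mult flip: distrib_left)
  then show ?thesis by (simp add: dot_norm norm_mult power_mult_distrib algebra_simps diff_divide_distrib)
qed

text \<open>
  The inner product of \<open>u\<close> and \<open>v\<close> is the real part of the conjugate of \<open>u\<close> times \<open>v\<close>.
\<close>

lemma inner_eq_real_part:
  fixes u v :: "'k::{real_normed_field,real_inner}"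
  shows "u \<bullet> v = (of_real ((norm u)\<^sup>2) / u * v) \<bullet> 1"
proof (cases "u = 0")
  case False
  then have "u \<bullet> v = (u * 1) \<bullet> (u * (v / u))" by simp
  also have "\<dots> = (norm u)\<^sup>2 * ((v / u) \<bullet> 1)" unfolding inner_mult_mult by (simp add: inner_commute)
  also have "\<dots> = ((norm u)\<^sup>2 *\<^sub>R (v / u)) \<bullet> 1" by simp
  finally show ?thesis by (simp add: scaleR_conv_of_real)
qed simp

text \<open>
  Both claims go through one induction: the value of \<open>\<phi>\<close> is available only for elements of the dual.
\<close>

lemma dual_combination:
  assumes X: "normed_space X" and "finite I" and "\<And>i. i \<in> I \<Longrightarrow> g i \<in> carr (dual X)"
  shows "(\<lambda>x\<in>carr X. \<Sum>i\<in>I. c i * g i x) \<in> carr (dual X) \<and>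
    (\<forall>\<phi>\<in>carr (dual (dual X)). \<phi> (\<lambda>x\<in>carr X. \<Sum>i\<in>I. c i * g i x) = (\<Sum>i\<in>I. c i * \<phi> (g i)))"
  using assms(2,3)
proof (induction I rule: finite_induct)
  case empty
  interpret D: normed_space "dual X" by (rule normed_space_dual[OF X])
  have zero: "(\<lambda>x\<in>carr X. 0) = zero (dual X)" by (simp add: dual_def)
  have "\<phi> (zero (dual X)) = 0" if "\<phi> \<in> carr (dual (dual X))" for \<phi>
    using dual_linear(2)[OF D.normed_space_axioms that D.zero_closed, of 0] D.smul_0[OF D.zero_closed]
    by simp
  then show ?case by (simp add: zero D.zero_closed)
next
  case (insert j I)
  interpret D: normed_space "dual X" by (rule normed_space_dual[OF X])
  define h where "h = (\<lambda>x\<in>carr X. \<Sum>i\<in>I. c i * g i x)"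
  have h: "h \<in> carr (dual X)"
    and \<phi>h: "\<And>\<phi>. \<phi> \<in> carr (dual (dual X)) \<Longrightarrow> \<phi> h = (\<Sum>i\<in>I. c i * \<phi> (g i))"
    using insert.IH insert.prems unfolding h_def by blast+
  have gj: "g j \<in> carr (dual X)" using insert.prems by simp
  have sum: "(\<lambda>x\<in>carr X. \<Sum>i\<in>insert j I. c i * g i x) = add (dual X) (smul (dual X) (c j) (g j)) h"
    using insert.hyps by (auto simp: dual_def h_def)
  show ?case
    unfolding sum using insert.hyps
    by (simp add: D.add_closed D.smul_closed h gj \<phi>h dual_linear[OF D.normed_space_axioms])
qed

text \<open>
  If the claim fails, the points \<open>(g x)\<^sub>g\<close> for \<open>x\<close> in the unit ball form a convex set at distance
  \<open>sqrt d > 0\<close> from the point \<open>(\<phi> g)\<^sub>g\<close>. Let \<open>u\<close> be the difference vector at an \<open>x\<close> that almost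
  attains the distance. Since moving from \<open>x\<close> towards any other \<open>y\<close> does not decrease the distance
  much, \<open>u\<close> separates: the combination \<open>h\<close> of the \<open>g\<close> with the conjugates of \<open>u\<close> as coefficients
  satisfies \<open>Re (h y - \<phi> h) \<ge> d / 2\<close> on the whole ball. As the ball is invariant under rotations,
  this makes the norm of \<open>h\<close> smaller than \<open>norm (\<phi> h)\<close>, a contradiction. A point that only almost attains the
  distance is enough, so the minimum need not exist.
\<close>

lemma helly:
  fixes X :: "('k::{real_normed_field,real_inner}, 'a) nspace"
  assumes X: "normed_space X" and \<phi>: "\<phi> \<in> unit_ball (dual (dual X))"
    and A: "finite A" "A \<subseteq> carr (dual X)" and \<epsilon>: "\<epsilon> > 0"
  shows "\<exists>x\<in>unit_ball X. \<forall>g\<in>A. norm (g x - \<phi> g) < \<epsilon>"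
proof (rule ccontr)
  assume contra: "\<not> ?thesis"
  interpret normed_space X by fact
  interpret D: normed_space "dual X" by (rule normed_space_dual[OF X])
  define Q where "Q x = (\<Sum>g\<in>A. (norm (g x - \<phi> g))\<^sup>2)" for x
  define d where "d = Inf (Q ` unit_ball X)"
  define M where "M = (\<Sum>g\<in>A. (2 * nrm (dual X) g)\<^sup>2)"
  have ball: "x \<in> carr X" "nrm X x \<le> 1" if "x \<in> unit_ball X" for x
    using that by (auto simp: unit_ball_def)
  have bdd: "bdd_below (Q ` unit_ball X)"
    by (intro bdd_belowI2[of _ 0]) (simp add: Q_def sum_nonneg)
  have d_le: "d \<le> Q x" if "x \<in> unit_ball X" for x
    unfolding d_def using that by (intro cINF_lower[OF bdd])
  have "\<epsilon>\<^sup>2 \<le> Q x" if x: "x \<in> unit_ball X" for x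
  proof -
    obtain g where g: "g \<in> A" "\<epsilon> \<le> norm (g x - \<phi> g)" using contra x by force
    have "\<epsilon>\<^sup>2 \<le> (norm (g x - \<phi> g))\<^sup>2" using g \<epsilon> by (intro power_mono) auto
    also have "\<dots> \<le> Q x" unfolding Q_def using g A by (intro member_le_sum) auto
    finally show ?thesis .
  qed
  then have "\<epsilon>\<^sup>2 \<le> d" unfolding d_def using zero_in_unit_ball[OF X] by (intro cINF_greatest) auto
  then have d: "d > 0" using \<epsilon> by (smt (verit) zero_less_power)
  have M: "M \<ge> 0" by (simp add: M_def sum_nonneg)
  \<comment> \<open>The length of the step from \<open>x\<close> towards \<open>y\<close>: small enough for the quadratic term
    of the squared distance to cost at most \<open>t * d / 2\<close>.\<close>
  define t where "t = min 1 (d / (2 * (M + 1)))"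
  have t: "0 < t" "t \<le> 1" "t * M \<le> d / 2"
  proof -
    show "0 < t" "t \<le> 1" using d M by (auto simp: t_def)
    have "t * M \<le> d / (2 * (M + 1)) * M" using M by (intro mult_right_mono) (auto simp: t_def)
    also have "\<dots> \<le> d / 2" using M d by (simp add: field_simps)
    finally show "t * M \<le> d / 2" .
  qed
  obtain x where x: "x \<in> unit_ball X" and Qx: "Q x < d + t * d / 2"
  proof -
    have "Inf (Q ` unit_ball X) < d + t * d / 2" using d t by (simp add: d_def)
    then show thesis
      using that zero_in_unit_ball[OF X] by (subst (asm) cInf_less_iff) (use bdd in auto)
  qed
  define u where "u g = g x - \<phi> g" for g
  define c where "c g = of_real ((norm (u g))\<^sup>2) / u g" for g
  define h where "h = (\<lambda>y\<in>carr X. \<Sum>g\<in>A. c g * g y)"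
  have h: "h \<in> carr (dual X)" and \<phi>h: "\<phi> h = (\<Sum>g\<in>A. c g * \<phi> g)"
    using dual_combination[OF X A(1), of "\<lambda>g. g" c] A \<phi> by (auto simp: h_def unit_ball_def)
  have step: "(h y - \<phi> h) \<bullet> 1 \<ge> d / 2" if y: "y \<in> unit_ball X" for y
  proof -
    define v where "v g = g y - g x" for g :: "'a \<Rightarrow> 'k"
    let ?z = "add X (smul X (of_real (1 - t)) x) (smul X (of_real t) y)"
    have "nrm X ?z \<le> nrm X (smul X (of_real (1 - t)) x) + nrm X (smul X (of_real t) y)"
      using ball[OF x] ball[OF y] by (intro nrm_triangle) (auto simp: smul_closed)
    also have "\<dots> \<le> (1 - t) * 1 + t * 1"
      unfolding nrm_smul[OF ball(1)[OF x]] nrm_smul[OF ball(1)[OF y]]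
      using ball[OF x] ball[OF y] t by (intro add_mono mult_mono) (auto simp del: of_real_diff simp: nrm_nonneg)
    finally have z: "?z \<in> unit_ball X"
      using ball[OF x] ball[OF y] by (simp add: unit_ball_def add_closed smul_closed)
    have gz: "g ?z - \<phi> g = u g + t *\<^sub>R v g" if "g \<in> A" for g
    proof -
      have "g \<in> carr (dual X)" using that A by blast
      then have "g ?z = of_real (1 - t) * g x + of_real t * g y"
        using ball[OF x] ball[OF y] by (simp only: dual_linear[OF X] smul_closed)
      then show ?thesis by (simp add: u_def v_def scaleR_conv_of_real algebra_simps)
    qed
    have "d \<le> Q ?z" by (rule d_le[OF z])
    also have "Q ?z = (\<Sum>g\<in>A. (norm (u g))\<^sup>2 + 2 * t * (u g \<bullet> v g) + t\<^sup>2 * (norm (v g))\<^sup>2)"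
      unfolding Q_def
    proof (intro sum.cong refl)
      fix g assume "g \<in> A"
      show "(norm (g ?z - \<phi> g))\<^sup>2 = (norm (u g))\<^sup>2 + 2 * t * (u g \<bullet> v g) + t\<^sup>2 * (norm (v g))\<^sup>2"
        unfolding gz[OF \<open>g \<in> A\<close>] power2_norm_eq_inner
        by (simp add: inner_add_left inner_add_right inner_commute[of "v g" "u g"] power2_eq_square algebra_simps)
    qed
    also have "\<dots> = Q x + 2 * t * (\<Sum>g\<in>A. u g \<bullet> v g) + t\<^sup>2 * (\<Sum>g\<in>A. (norm (v g))\<^sup>2)"
      by (simp add: Q_def u_def sum.distrib sum_distrib_left)
    also have "(\<Sum>g\<in>A. (norm (v g))\<^sup>2) \<le> M"
      unfolding M_def
    proof (intro sum_mono power_mono)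
      fix g assume "g \<in> A"
      then have g: "g \<in> carr (dual X)" using A by blast
      show "norm (v g) \<le> 2 * nrm (dual X) g"
        unfolding v_def using norm_triangle_ineq4[of "g y" "g x"]
          dual_apply_le_unit_ball[OF X g x] dual_apply_le_unit_ball[OF X g y] by linarith
    qed simp
    finally have "d \<le> Q x + 2 * t * (\<Sum>g\<in>A. u g \<bullet> v g) + t\<^sup>2 * M"
      by (simp add: mult_left_mono)
    moreover have "t\<^sup>2 * M \<le> t * (d / 2)"
      using mult_left_mono[OF t(3), of t] t(1) by (simp add: power2_eq_square)
    ultimately have "0 < t * (d + 2 * (\<Sum>g\<in>A. u g \<bullet> v g))"
      using Qx by (simp add: algebra_simps)
    then have cross: "- d / 2 \<le> (\<Sum>g\<in>A. u g \<bullet> v g)"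
      using t(1) by (simp add: zero_less_mult_iff)
    have "h y - \<phi> h = (\<Sum>g\<in>A. c g * (u g + v g))"
    proof -
      have "h y = (\<Sum>g\<in>A. c g * g y)" using ball[OF y] by (simp add: h_def)
      then show ?thesis by (simp add: \<phi>h u_def v_def right_diff_distrib sum_subtractf)
    qed
    then have "(h y - \<phi> h) \<bullet> 1 = (\<Sum>g\<in>A. u g \<bullet> (u g + v g))"
      by (simp add: inner_sum_left inner_eq_real_part[of "u _"] c_def)
    also have "\<dots> = Q x + (\<Sum>g\<in>A. u g \<bullet> v g)"
      by (simp add: inner_add_right sum.distrib Q_def u_def power2_norm_eq_inner)
    finally show ?thesis using d_le[OF x] cross by linarith
  qed
  have "norm (h y) \<le> - (\<phi> h \<bullet> 1) - d / 2" if y: "y \<in> unit_ball X" for y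
  proof (cases "h y = 0")
    case True
    then show ?thesis using step[OF y] by (simp add: inner_diff_left)
  next
    case False
    \<comment> \<open>The rotation that makes \<open>h y\<close> real and negative.\<close>
    define w where "w = - of_real (norm (h y)) / h y"
    have "norm w = 1" using False by (simp add: w_def norm_divide)
    then have "smul X w y \<in> unit_ball X"
      using ball[OF y] by (simp add: unit_ball_def smul_closed nrm_smul)
    from step[OF this] have "d / 2 \<le> (w * h y - \<phi> h) \<bullet> 1"
      using dual_linear(2)[OF X h ball(1)[OF y]] by simp
    moreover have "w * h y = (- norm (h y)) *\<^sub>R 1"
      using False by (simp add: w_def scaleR_conv_of_real)
    ultimately show ?thesis by (simp add: inner_diff_left dot_square_norm)
  qed
  then have "nrm (dual X) h \<le> - (\<phi> h \<bullet> 1) - d / 2" by (rule dual_nrm_le[OF X])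
  moreover have "\<bar>\<phi> h \<bullet> 1\<bar> \<le> norm (\<phi> h)" using Cauchy_Schwarz_ineq2[of "\<phi> h" 1] by simp
  moreover have "norm (\<phi> h) \<le> nrm (dual X) h"
    using \<phi> h by (simp add: in_dual_unit_ball_iff[OF D.normed_space_axioms])
  ultimately show False using d by linarith
qed

text \<open>
  Helly's lemma says that the sets of points of the unit ball on which finitely many functionals are
  close to their values under \<open>\<phi>\<close> generate a proper filter. Along it, evaluations converge to \<open>\<phi>\<close>.
\<close>

lemma goldstine:
  fixes X :: "('k::{real_normed_field,real_inner}, 'a) nspace"
  assumes X: "normed_space X" and \<phi>: "\<phi> \<in> unit_ball (dual (dual X))"
  obtains F where "F \<noteq> bot" "eventually (\<lambda>x. x \<in> unit_ball X) F"
    "\<And>g. g \<in> carr (dual X) \<Longrightarrow> (g \<longlongrightarrow> \<phi> g) F"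
proof -
  define I where "I = {(A, \<epsilon>::real). finite A \<and> A \<subseteq> carr (dual X) \<and> \<epsilon> > 0}"
  define N where "N = (\<lambda>(A, \<epsilon>). {x \<in> unit_ball X. \<forall>g\<in>A. norm (g x - \<phi> g) < \<epsilon>})"
  define F where "F = (INF i\<in>I. principal (N i))"
  have "eventually P F \<longleftrightarrow> (\<exists>i\<in>I. eventually P (principal (N i)))" for P
    unfolding F_def
  proof (rule eventually_INF_base)
    have "({}, 1) \<in> I" by (simp add: I_def)
    then show "I \<noteq> {}" by blast
    fix i j assume "i \<in> I" "j \<in> I"
    then show "\<exists>k\<in>I. principal (N k) \<le> inf (principal (N i)) (principal (N j))"
      by (intro bexI[of _ "(fst i \<union> fst j, min (snd i) (snd j))"]) (auto simp: I_def N_def)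
  qed
  then have ev: "eventually P F \<longleftrightarrow> (\<exists>(A,\<epsilon>)\<in>I. \<forall>x\<in>N (A,\<epsilon>). P x)" for P
    by (auto simp: eventually_principal)
  show thesis
  proof
    have "N (A, \<epsilon>) \<noteq> {}" if "(A, \<epsilon>) \<in> I" for A \<epsilon>
      using helly[OF X \<phi>, of A \<epsilon>] that by (auto simp: I_def N_def)
    then have "\<not> eventually (\<lambda>_. False) F" unfolding ev by fastforce
    then show "F \<noteq> bot" by (simp add: trivial_limit_def)
    show "eventually (\<lambda>x. x \<in> unit_ball X) F"
      unfolding ev by (intro bexI[of _ "({}, 1)"]) (auto simp: I_def N_def)
    fix g assume g: "g \<in> carr (dual X)"
    have "eventually (\<lambda>x. dist (g x) (\<phi> g) < \<epsilon>) F" if "\<epsilon> > 0" for \<epsilon>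
      unfolding ev using that g by (intro bexI[of _ "({g}, \<epsilon>)"]) (auto simp: I_def N_def dist_norm)
    then show "(g \<longlongrightarrow> \<phi> g) F" by (simp add: tendsto_iff)
  qed
qed

section \<open>The weak topology\<close>

lemma continuous_map_weak_topology:
  fixes X :: "('k::real_normed_field, 'a) nspace"
  assumes X: "normed_space X" and f: "f \<in> carr (dual X)"
  shows "continuous_map (weak_topology X) euclidean f"
  unfolding continuous_map
proof (intro conjI allI impI)
  fix U :: "'k set" assume "openin euclidean U"
  then have "{x \<in> carr X. f x \<in> U} \<in> {{x \<in> carr X. f x \<in> U} | f U. f \<in> carr (dual X) \<and> open U}"
    using f by auto
  then show "openin (weak_topology X) {x \<in> topspace (weak_topology X). f x \<in> U}"
    unfolding normed_space.topspace_weak_topology[OF X]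
    by (subst weak_topology_def) (rule topology_generated_by_Basis)
qed simp

lemma limitin_weak_topologyD:
  assumes "normed_space X" "limitin (weak_topology X) s l F" "f \<in> carr (dual X)"
  shows "((\<lambda>i. f (s i)) \<longlongrightarrow> f l) F"
  using continuous_map_limit[OF continuous_map_weak_topology[OF assms(1,3)] assms(2)]
  by (simp add: o_def)

lemma continuous_map_into_weak_topology:
  assumes X: "normed_space X" and h: "h \<in> topspace T \<rightarrow> carr X"
    and cont: "\<And>f. f \<in> carr (dual X) \<Longrightarrow> continuous_map T euclidean (\<lambda>t. f (h t))"
  shows "continuous_map T (weak_topology X) h"
proof -
  have top: "\<Union>{{x \<in> carr X. f x \<in> U} | f U. f \<in> carr (dual X) \<and> open U} = carr X"
    using normed_space.topspace_weak_topology[OF X]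
    unfolding weak_topology_def topology_generated_by_topspace .
  show ?thesis
    unfolding weak_topology_def
  proof (rule continuous_on_generated_topo)
    show "h ` topspace T \<subseteq> \<Union>{{x \<in> carr X. f x \<in> U} | f U. f \<in> carr (dual X) \<and> open U}"
      unfolding top using h by auto
    fix W assume "W \<in> {{x \<in> carr X. f x \<in> U} | f U. f \<in> carr (dual X) \<and> open U}"
    then obtain f U where W: "W = {x \<in> carr X. f x \<in> U}" and f: "f \<in> carr (dual X)" and U: "open U"
      by blast
    have "h -` W \<inter> topspace T = {t \<in> topspace T. f (h t) \<in> U}" using h W by auto
    then show "openin T (h -` W \<inter> topspace T)"
      using openin_continuous_map_preimage[OF cont[OF f], of U] U by simp
  qed
qed

text \<open>
  Relative compactness asks for the closure of \<open>S\<close> to be compact. It is a closed subset of \<open>K\<close> as soon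
  as \<open>K\<close> is closed, which needs the weak topology to be Hausdorff; the separation hypothesis provides
  this. For dual spaces and for \<open>c\<^sub>0\<close> it holds because evaluations and coordinates are functionals.
\<close>

lemma relatively_weakly_compactI:
  assumes X: "normed_space X"
    and separates: "\<And>x y. x \<in> carr X \<Longrightarrow> y \<in> carr X \<Longrightarrow> x \<noteq> y \<Longrightarrow> \<exists>f\<in>carr (dual X). f x \<noteq> f y"
    and K: "compactin (weak_topology X) K" and S: "S \<subseteq> K"
  shows "relatively_weakly_compact X S"
proof -
  have top: "topspace (weak_topology X) = carr X"
    by (rule normed_space.topspace_weak_topology[OF X])
  have "Hausdorff_space (weak_topology X)"
    unfolding Hausdorff_space_def top
  proof (intro allI impI, elim conjE)
    fix x y assume xy: "x \<in> carr X" "y \<in> carr X" "x \<noteq> y"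
    then obtain f where f: "f \<in> carr (dual X)" "f x \<noteq> f y" using separates by blast
    obtain U V where UV: "open U" "open V" "f x \<in> U" "f y \<in> V" "U \<inter> V = {}"
      using hausdorff[OF f(2)] by blast
    let ?pre = "\<lambda>U. {x \<in> topspace (weak_topology X). f x \<in> U}"
    show "\<exists>U V. openin (weak_topology X) U \<and> openin (weak_topology X) V \<and> x \<in> U \<and> y \<in> V \<and> disjnt U V"
    proof (intro exI conjI)
      show "openin (weak_topology X) (?pre U)" "openin (weak_topology X) (?pre V)"
        using UV(1,2) openin_continuous_map_preimage[OF continuous_map_weak_topology[OF X f(1)]]
        by simp_all
      show "x \<in> ?pre U" "y \<in> ?pre V" using UV(3,4) xy(1,2) by (simp_all add: top)
      show "disjnt (?pre U) (?pre V)" using UV(5) unfolding disjnt_def by blast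
    qed
  qed
  then have "closedin (weak_topology X) K" using K by (intro compactin_imp_closedin)
  then have "weak_topology X closure_of S \<subseteq> K" using S by (intro closure_of_minimal)
  then have "compactin (weak_topology X) (weak_topology X closure_of S)"
    by (rule closed_compactin[OF K _ closedin_closure_of])
  moreover have "S \<subseteq> carr X" using S compactin_subset_topspace[OF K] top by blast
  ultimately show ?thesis by (simp add: relatively_weakly_compact_def)
qed

lemma relatively_weakly_compact_cluster_point:
  assumes X: "normed_space X" and S: "relatively_weakly_compact X S"
    and "F \<noteq> bot" "eventually (\<lambda>i. s i \<in> S) F"
  obtains l G where "l \<in> carr X" "G \<le> F" "G \<noteq> bot" "\<And>f. f \<in> carr (dual X) \<Longrightarrow> ((\<lambda>i. f (s i)) \<longlongrightarrow> f l) G"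
proof -
  have top: "topspace (weak_topology X) = carr X"
    by (rule normed_space.topspace_weak_topology[OF X])
  have K: "compactin (weak_topology X) (weak_topology X closure_of S)"
    and "S \<subseteq> topspace (weak_topology X)"
    using S top by (simp_all add: relatively_weakly_compact_def)
  then have "S \<subseteq> weak_topology X closure_of S" by (intro closure_of_subset)
  then have "eventually (\<lambda>i. s i \<in> weak_topology X closure_of S) F"
    using assms(4) by (auto elim: eventually_mono)
  from compactin_cluster_point[OF K assms(3) this] obtain l G where
    "l \<in> weak_topology X closure_of S" and G: "G \<le> F" "G \<noteq> bot" "limitin (weak_topology X) s l G"
    by metis
  then have "l \<in> carr X" using top limitin_topspace by fastforce
  then show thesis using that G limitin_weak_topologyD[OF X G(3)] by blast
qed

text \<open>
  Used to pass from functionals of norm at most 1 to arbitrary ones. The radius is \<open>nrm X x + 1\<close>, so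
  that the zero vector is no exception.
\<close>

lemma ex_scaled_unit_ball:
  assumes X: "normed_space X" and x: "x \<in> carr X"
  obtains r y where "r > 0" "y \<in> unit_ball X" "x = smul X (of_real r) y"
proof -
  interpret normed_space X by fact
  let ?r = "nrm X x + 1"
  have r: "?r > 0" using nrm_nonneg[OF x] by simp
  let ?y = "smul X (of_real (1 / ?r)) x"
  have "?y \<in> unit_ball X"
    using x nrm_nonneg[OF x] by (simp add: unit_ball_def smul_closed nrm_smul del: of_real_add of_real_divide)
  moreover have "of_real ?r * of_real (1 / ?r) = (1 :: 'a)"
    using r by (subst of_real_mult[symmetric]) simp
  then have "x = smul X (of_real ?r) ?y"
    using x by (simp only: smul_smul smul_one)
  ultimately show thesis using that r by blast
qed

lemma evaluation_in_bidual:
  assumes X: "normed_space X" and x: "x \<in> carr X"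
  shows "(\<lambda>f\<in>carr (dual X). f x) \<in> carr (dual (dual X))"
proof (rule dualI[OF normed_space_dual[OF X], where C = "nrm X x"])
  show "norm (f x) \<le> nrm X x * nrm (dual X) f" if "f \<in> carr (dual X)" for f
    using dual_apply_le[OF X that x] by (simp add: mult.commute)
qed (use x in \<open>simp_all add: dual_simps\<close>)

lemma evaluation_in_bidual_unit_ball:
  assumes X: "normed_space X" and x: "x \<in> unit_ball X"
  shows "(\<lambda>f\<in>carr (dual X). f x) \<in> unit_ball (dual (dual X))"
proof -
  interpret D: normed_space "dual X" by (rule normed_space_dual[OF X])
  have x': "x \<in> carr X" using x by (simp add: unit_ball_def)
  have "nrm (dual (dual X)) (\<lambda>f\<in>carr (dual X). f x) \<le> 1"
  proof (rule dual_nrm_le[OF D.normed_space_axioms])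
    fix f assume "f \<in> unit_ball (dual X)"
    then have f: "f \<in> carr (dual X)" "nrm (dual X) f \<le> 1" by (auto simp: unit_ball_def)
    then show "norm ((\<lambda>f\<in>carr (dual X). f x) f) \<le> 1"
      using dual_apply_le_unit_ball[OF X f(1) x] by simp
  qed
  then show ?thesis using evaluation_in_bidual[OF X x'] by (simp add: unit_ball_def)
qed

lemma dual_separated:
  assumes X: "normed_space X" and fg: "f \<in> carr (dual X)" "g \<in> carr (dual X)" "f \<noteq> g"
  shows "\<exists>\<phi>\<in>carr (dual (dual X)). \<phi> f \<noteq> \<phi> g"
proof -
  obtain x where "x \<in> carr X" "f x \<noteq> g x" using dual_ext[OF X fg(1,2)] fg(3) by blast
  then show ?thesis
    using fg by (intro bexI[OF _ evaluation_in_bidual[OF X, of x]]) auto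
qed

section \<open>Adjoints of weakly compact operators\<close>

lemma operator_boundE:
  assumes X: "normed_space X" and Y: "normed_space Y" and T: "operator X Y T"
  obtains C where "0 \<le> C" "\<And>x. x \<in> carr X \<Longrightarrow> nrm Y (T x) \<le> C * nrm X x"
proof -
  obtain C where C: "\<And>x. x \<in> carr X \<Longrightarrow> nrm Y (T x) \<le> C * nrm X x"
    using T unfolding operator_iff_bounded[OF X Y] by blast
  have "nrm Y (T x) \<le> max 0 C * nrm X x" if "x \<in> carr X" for x
    using C[OF that] mult_right_mono[of C "max 0 C" "nrm X x"] normed_space.nrm_nonneg[OF X that]
    by linarith
  then show thesis by (intro that[of "max 0 C"]) auto
qed

lemma compose_dual:
  assumes X: "normed_space X" and Y: "normed_space Y" and T: "operator X Y T"
    and g: "g \<in> carr (dual Y)"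
  shows "(\<lambda>x\<in>carr X. g (T x)) \<in> carr (dual X)"
proof -
  obtain C where C: "0 \<le> C" "\<And>x. x \<in> carr X \<Longrightarrow> nrm Y (T x) \<le> C * nrm X x"
    by (rule operator_boundE[OF X Y T]) (rule that)
  have T': "T x \<in> carr Y" if "x \<in> carr X" for x using T that by (auto simp: operator_def)
  have "norm (g (T x)) \<le> (nrm (dual Y) g * C) * nrm X x" if x: "x \<in> carr X" for x
    using dual_apply_le[OF Y g T'[OF x]] mult_left_mono[OF C(2)[OF x] dual_nrm_nonneg[OF Y g]]
    by simp
  then show ?thesis
    using T T' by (intro dualI[OF X]) (auto simp: operator_def dual_linear[OF Y g])
qed

text \<open>
  The bidual operator takes its values in \<open>Y\<close>: by Goldstine's theorem \<open>\<phi>\<close> is a limit of points \<open>x\<close>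
  of the unit ball, and any weak cluster point \<open>y\<close> of \<open>T x\<close> represents the image of \<open>\<phi>\<close>.
\<close>

lemma weakly_compact_operator_bidual:
  fixes X :: "('k::{real_normed_field,real_inner}, 'a) nspace" and Y :: "('k, 'b) nspace"
  assumes X: "normed_space X" and Y: "normed_space Y" and T: "weakly_compact_operator X Y T"
    and \<phi>: "\<phi> \<in> unit_ball (dual (dual X))"
  obtains y where "y \<in> carr Y" "\<And>g. g \<in> carr (dual Y) \<Longrightarrow> \<phi> (\<lambda>x\<in>carr X. g (T x)) = g y"
proof -
  have op: "operator X Y T" and rwc: "relatively_weakly_compact Y (T ` unit_ball X)"
    using T by (auto simp: weakly_compact_operator_def)
  obtain F where F: "F \<noteq> bot" and ball: "eventually (\<lambda>x. x \<in> unit_ball X) F"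
    and lim: "\<And>f. f \<in> carr (dual X) \<Longrightarrow> (f \<longlongrightarrow> \<phi> f) F"
    using goldstine[OF X \<phi>] by blast
  have "eventually (\<lambda>x. T x \<in> T ` unit_ball X) F"
    using ball by eventually_elim blast
  then obtain y G where y: "y \<in> carr Y" and G: "G \<le> F" "G \<noteq> bot"
    and limy: "\<And>g. g \<in> carr (dual Y) \<Longrightarrow> ((\<lambda>x. g (T x)) \<longlongrightarrow> g y) G"
    using relatively_weakly_compact_cluster_point[OF Y rwc F] by blast
  have "\<phi> (\<lambda>x\<in>carr X. g (T x)) = g y" if g: "g \<in> carr (dual Y)" for g
  proof (rule tendsto_unique[OF G(2) _ limy[OF g]])
    have "((\<lambda>x\<in>carr X. g (T x)) \<longlongrightarrow> \<phi> (\<lambda>x\<in>carr X. g (T x))) G"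
      using lim[OF compose_dual[OF X Y op g]] G(1) by (rule tendsto_mono[rotated])
    moreover have "eventually (\<lambda>x. (\<lambda>x\<in>carr X. g (T x)) x = g (T x)) G"
      using filter_leD[OF G(1) ball] by eventually_elim (simp add: unit_ball_def)
    ultimately show "((\<lambda>x. g (T x)) \<longlongrightarrow> \<phi> (\<lambda>x\<in>carr X. g (T x))) G"
      by (rule Lim_transform_eventually)
  qed
  with y show thesis by (rule that)
qed

text \<open>
  One direction of Gantmacher's theorem. A functional \<open>\<phi>\<close> on the dual of \<open>X\<close>, composed
  with the adjoint, is the evaluation at a point of \<open>Y\<close>. So the adjoint is continuous from the
  topology of pointwise convergence to the weak topology, and the image of the compact dual ball is
  weakly compact.
\<close>

lemma adjoint_relatively_weakly_compact:
  fixes X :: "('k::{real_normed_field,real_inner,heine_borel}, 'a) nspace" and Y :: "('k, 'b) nspace"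
  assumes X: "normed_space X" and Y: "normed_space Y" and T: "weakly_compact_operator X Y T"
  shows "relatively_weakly_compact (dual X) ((\<lambda>g. \<lambda>x\<in>carr X. g (T x)) ` unit_ball (dual Y))"
proof (rule relatively_weakly_compactI[OF normed_space_dual[OF X] dual_separated[OF X]])
  let ?adj = "\<lambda>g. \<lambda>x\<in>carr X. g (T x)"
  let ?B = "subtopology (pointwise_topology Y) (unit_ball (dual Y))"
  have D: "normed_space (dual X)" and DD: "normed_space (dual (dual X))"
    using X by (auto intro: normed_space_dual)
  have adj: "?adj g \<in> carr (dual X)" if "g \<in> unit_ball (dual Y)" for g
    using that T by (intro compose_dual[OF X Y]) (simp_all add: unit_ball_def weakly_compact_operator_def)
  have "continuous_map ?B (weak_topology (dual X)) ?adj"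
  proof (rule continuous_map_into_weak_topology[OF D])
    show "?adj \<in> topspace ?B \<rightarrow> carr (dual X)" using adj by auto
    fix \<phi> assume \<phi>: "\<phi> \<in> carr (dual (dual X))"
    obtain r \<psi> where \<psi>: "\<psi> \<in> unit_ball (dual (dual X))" and \<phi>\<psi>: "\<phi> = smul (dual (dual X)) (of_real r) \<psi>"
      using ex_scaled_unit_ball[OF DD \<phi>] by metis
    obtain y where y: "y \<in> carr Y" "\<And>g. g \<in> carr (dual Y) \<Longrightarrow> \<psi> (?adj g) = g y"
      using weakly_compact_operator_bidual[OF X Y T \<psi>] by blast
    have "continuous_map ?B euclidean (\<lambda>g. of_real r * g y)"
    proof -
      have "continuous_map euclidean euclidean (\<lambda>z::'k. of_real r * z)"
        by (simp add: continuous_map_iff_continuous2 continuous_intros)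
      from continuous_map_compose[OF continuous_map_product_projection[OF y(1)] this]
      show ?thesis by (intro continuous_map_from_subtopology) (simp add: o_def)
    qed
    then show "continuous_map ?B euclidean (\<lambda>g. \<phi> (?adj g))"
    proof (rule continuous_map_eq)
      fix g assume "g \<in> topspace ?B"
      then have g: "g \<in> unit_ball (dual Y)" "g \<in> carr (dual Y)" by (auto simp: unit_ball_def)
      show "of_real r * g y = \<phi> (?adj g)"
        unfolding \<phi>\<psi> dual_simps(2)[OF adj[OF g(1)]] y(2)[OF g(2)] ..
    qed
  qed
  moreover have "compactin ?B (unit_ball (dual Y))"
    by (simp add: compactin_subtopology compactin_dual_unit_ball[OF Y])
  ultimately show "compactin (weak_topology (dual X)) (?adj ` unit_ball (dual Y))"
    by (rule image_compactin[rotated])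
qed simp_all

section \<open>Weakly p-summable sequences\<close>

text \<open>
  Young's inequality, applied to each summand after dividing \<open>b\<close> by its p-norm.
\<close>

lemma holder_normalized:
  fixes a b :: "'i \<Rightarrow> real"
  assumes p: "1 < p" and q: "1 < q" and pq: "1 / p + 1 / q = 1"
    and nonneg: "\<And>i. i \<in> I \<Longrightarrow> 0 \<le> a i" "\<And>i. i \<in> I \<Longrightarrow> 0 \<le> b i"
    and a: "(\<Sum>i\<in>I. a i powr q) \<le> 1"
  shows "(\<Sum>i\<in>I. a i * b i) powr p \<le> (\<Sum>i\<in>I. b i powr p)"
proof (cases "finite I")
  case True
  define S where "S = (\<Sum>i\<in>I. b i powr p)"
  define B where "B = S powr (1 / p)"
  have S: "S \<ge> 0" by (simp add: S_def sum_nonneg)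
  have Bp: "B powr p = S" using p S by (simp add: B_def powr_powr)
  show ?thesis
  proof (cases "S = 0")
    case True
    then have "b i = 0" if "i \<in> I" for i
      using that \<open>finite I\<close> p by (simp add: S_def sum_nonneg_eq_0_iff)
    then show ?thesis by (simp add: sum_nonneg)
  next
    case False
    then have B: "B > 0" using S by (simp add: B_def)
    have "(\<Sum>i\<in>I. a i * b i) = B * (\<Sum>i\<in>I. a i * (b i / B))"
      using B by (simp add: sum_distrib_left)
    also have "(\<Sum>i\<in>I. a i * (b i / B)) \<le> (\<Sum>i\<in>I. a i powr q / q + (b i / B) powr p / p)"
      using p q pq nonneg B by (intro sum_mono Youngs_inequality) auto
    also have "\<dots> = (\<Sum>i\<in>I. a i powr q) / q + S / B powr p / p"
      using nonneg B by (simp add: sum.distrib sum_divide_distrib powr_divide S_def)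
    also have "S / B powr p = 1" using False by (simp add: Bp)
    also have "(\<Sum>i\<in>I. a i powr q) / q + 1 / p \<le> 1 / q + 1 / p"
      using a q by (intro add_right_mono divide_right_mono) auto
    also have "1 / q + 1 / p = 1" using pq by simp
    finally have "(\<Sum>i\<in>I. a i * b i) \<le> B" using B by simp
    then have "(\<Sum>i\<in>I. a i * b i) powr p \<le> B powr p"
      using p nonneg by (intro powr_mono2) (auto intro: sum_nonneg)
    then show ?thesis by (simp add: Bp S_def)
  qed
qed simp

text \<open>
  Equality in Hoelder's inequality is attained when \<open>(norm (a i)) powr q\<close> is proportional to
  \<open>(norm (b i)) powr p\<close> and the phase of \<open>a i\<close> cancels that of \<open>b i\<close>.
\<close>

lemma holder_extremal:
  fixes b :: "'i \<Rightarrow> 'k::real_normed_field"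
  assumes p: "1 < p" and q: "1 < q" and pq: "1 / p + 1 / q = 1"
    and S: "(\<Sum>i\<in>I. norm (b i) powr p) > 0" (is "?S > 0")
  obtains a where "(\<Sum>i\<in>I. norm (a i) powr q) \<le> 1"
    "(\<Sum>i\<in>I. a i * b i) = of_real ((\<Sum>i\<in>I. norm (b i) powr p) powr (1 / p))"
proof
  have pq': "(p - 1) * q = p" "1 - 1 / q = 1 / p" using pq p q by (simp_all add: field_simps)
  define a where "a i = of_real (norm (b i) powr p / ?S powr (1 / q)) / b i" for i
  have "norm (a i) powr q = norm (b i) powr p / ?S" for i
  proof (cases "b i = 0")
    case False
    then have "norm (a i) = norm (b i) powr (p - 1) / ?S powr (1 / q)"
      by (simp add: a_def norm_divide powr_diff del: of_real_divide)
    then have "norm (a i) powr q = norm (b i) powr ((p - 1) * q) / ?S powr (1 / q * q)"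
      by (simp add: powr_divide powr_powr)
    then show ?thesis using q S pq' by simp
  qed (use p in \<open>simp add: a_def\<close>)
  then show "(\<Sum>i\<in>I. norm (a i) powr q) \<le> 1"
    using S by (simp flip: sum_divide_distrib)
  have "a i * b i = of_real (norm (b i) powr p / ?S powr (1 / q))" for i
    using p by (simp add: a_def)
  then have "(\<Sum>i\<in>I. a i * b i) = of_real (?S / ?S powr (1 / q))"
    by (simp only: of_real_sum[symmetric] sum_divide_distrib)
  also have "?S / ?S powr (1 / q) = ?S powr (1 - 1 / q)"
    using S by (simp add: powr_diff)
  finally show "(\<Sum>i\<in>I. a i * b i) = of_real (?S powr (1 / p))" by (simp only: pq')
qed

text \<open>
  Bounded partial sums are easier to verify than convergence together with a bounded supremum of
  roots.
\<close>

lemma weakly_summable_iff: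
  fixes X :: "('k::real_normed_field, 'a) nspace"
  assumes X: "normed_space X" and p: "1 < p"
  shows "x \<in> weakly_summable p X \<longleftrightarrow> range x \<subseteq> carr X \<and>
    (\<exists>M. \<forall>f\<in>unit_ball (dual X). \<forall>N. (\<Sum>n<N. norm (f (x n)) powr p) \<le> M)"
    (is "_ \<longleftrightarrow> _ \<and> ?bounded")
proof -
  have tail: "tail_norm p a 0 powr p = (\<Sum>n. norm (a n) powr p)"
    if "summable (\<lambda>n. norm (a n) powr p)" for a :: "nat \<Rightarrow> 'k"
    using that p by (simp add: tail_norm_def powr_powr suminf_nonneg)
  have "(\<forall>f\<in>unit_ball (dual X). summable (\<lambda>n. norm (f (x n)) powr p)) \<and>
      bdd_above ((\<lambda>f. tail_norm p (\<lambda>n. f (x n)) 0) ` unit_ball (dual X)) \<longleftrightarrow> ?bounded"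
    (is "?summable \<and> ?bdd \<longleftrightarrow> _")
  proof (intro iffI conjI)
    assume *: "?summable \<and> ?bdd"
    then obtain M where M: "\<And>f. f \<in> unit_ball (dual X) \<Longrightarrow> tail_norm p (\<lambda>n. f (x n)) 0 \<le> M"
      by (auto simp: bdd_above_def)
    have "(\<Sum>n<N. norm (f (x n)) powr p) \<le> M powr p" if f: "f \<in> unit_ball (dual X)" for f N
    proof -
      have s: "summable (\<lambda>n. norm (f (x n)) powr p)" using * f by blast
      have "(\<Sum>n<N. norm (f (x n)) powr p) \<le> (\<Sum>n. norm (f (x n)) powr p)"
        by (intro sum_le_suminf[OF s]) auto
      also have "\<dots> = tail_norm p (\<lambda>n. f (x n)) 0 powr p" by (rule tail[OF s, symmetric])
      also have "\<dots> \<le> M powr p"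
        using M[OF f] p by (intro powr_mono2) (auto simp: tail_norm_def)
      finally show ?thesis .
    qed
    then show ?bounded by blast
  next
    assume ?bounded
    then obtain M where M: "\<And>f N. f \<in> unit_ball (dual X) \<Longrightarrow> (\<Sum>n<N. norm (f (x n)) powr p) \<le> M"
      by blast
    show summable: ?summable
      using M by (auto intro!: summableI_nonneg_bounded)
    have "tail_norm p (\<lambda>n. f (x n)) 0 \<le> M powr (1 / p)" if f: "f \<in> unit_ball (dual X)" for f
      unfolding tail_norm_def using p summable M f
      by (intro powr_mono2 suminf_nonneg) (auto intro: suminf_le_const)
    then show ?bdd by (rule bdd_aboveI2)
  qed
  then show ?thesis by (auto simp: weakly_summable_def)
qed

text \<open>
  The linear combination of the \<open>x i\<close>. Only the values of functionals at it will matter, so it is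
  introduced by these.
\<close>

lemma ex_combination:
  assumes X: "normed_space X" and "finite I" and "\<And>i. i \<in> I \<Longrightarrow> x i \<in> carr X"
  shows "\<exists>z\<in>carr X. \<forall>f\<in>carr (dual X). f z = (\<Sum>i\<in>I. a i * f (x i))"
  using assms(2,3)
proof (induction I rule: finite_induct)
  case empty
  interpret normed_space X by fact
  have "f (zero X) = 0" if "f \<in> carr (dual X)" for f
    using dual_linear(2)[OF X that zero_closed, of 0] smul_0[OF zero_closed] by simp
  then show ?case using zero_closed by auto
next
  case (insert j I)
  interpret normed_space X by fact
  obtain z where z: "z \<in> carr X" "\<And>f. f \<in> carr (dual X) \<Longrightarrow> f z = (\<Sum>i\<in>I. a i * f (x i))"
    using insert.IH insert.prems by blast
  have xj: "x j \<in> carr X" using insert.prems by simp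
  have "f (add X (smul X (a j) (x j)) z) = (\<Sum>i\<in>insert j I. a i * f (x i))"
    if f: "f \<in> carr (dual X)" for f
    using insert.hyps by (simp add: dual_linear[OF X f] z f xj smul_closed)
  moreover have "add X (smul X (a j) (x j)) z \<in> carr X" using z(1) xj by (simp add: add_closed smul_closed)
  ultimately show ?case by blast
qed

lemma sum_blocks:
  fixes c :: "nat \<Rightarrow> real"
  assumes "mono m"
  shows "(\<Sum>k<K. \<Sum>i\<in>{m k..<m (Suc k)}. c i) = (\<Sum>i\<in>{m 0..<m K}. c i)"
proof (induction K)
  case (Suc K)
  have "m 0 \<le> m K" "m K \<le> m (Suc K)" using assms by (auto intro: monoD)
  then show ?case using Suc by (simp add: sum.atLeastLessThan_concat)
qed simp

text \<open>
  By Hoelder's inequality \<open>norm (f (z k)) powr p\<close> is at most the part of the series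
  \<open>\<Sum>i. norm (f (x i)) powr p\<close> that belongs to the k-th block, and the blocks are disjoint.
\<close>

lemma weakly_summable_blocks:
  assumes X: "normed_space X" and p: "1 < p" and q: "1 < q" and pq: "1 / p + 1 / q = 1"
    and x: "x \<in> weakly_summable p X" and m: "mono m"
    and a: "\<And>k. (\<Sum>i\<in>{m k..<m (Suc k)}. norm (a k i) powr q) \<le> 1"
    and z: "\<And>k. z k \<in> carr X"
      "\<And>k f. f \<in> carr (dual X) \<Longrightarrow> f (z k) = (\<Sum>i\<in>{m k..<m (Suc k)}. a k i * f (x i))"
  shows "z \<in> weakly_summable p X"
proof -
  obtain M where M: "\<And>f N. f \<in> unit_ball (dual X) \<Longrightarrow> (\<Sum>n<N. norm (f (x n)) powr p) \<le> M"
    using x unfolding weakly_summable_iff[OF X p] by blast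
  have "(\<Sum>k<K. norm (f (z k)) powr p) \<le> M" if f: "f \<in> unit_ball (dual X)" for f K
  proof -
    have f': "f \<in> carr (dual X)" using f by (simp add: unit_ball_def)
    have "norm (f (z k)) powr p \<le> (\<Sum>i\<in>{m k..<m (Suc k)}. norm (f (x i)) powr p)" for k
    proof -
      have "norm (f (z k)) \<le> (\<Sum>i\<in>{m k..<m (Suc k)}. norm (a k i) * norm (f (x i)))"
        unfolding z(2)[OF f'] using norm_sum by (metis (mono_tags, lifting) norm_mult sum.cong)
      then have "norm (f (z k)) powr p \<le> (\<Sum>i\<in>{m k..<m (Suc k)}. norm (a k i) * norm (f (x i))) powr p"
        using p by (intro powr_mono2) auto
      also have "\<dots> \<le> (\<Sum>i\<in>{m k..<m (Suc k)}. norm (f (x i)) powr p)"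
        using a by (intro holder_normalized[OF p q pq]) auto
      finally show ?thesis .
    qed
    then have "(\<Sum>k<K. norm (f (z k)) powr p)
        \<le> (\<Sum>k<K. \<Sum>i\<in>{m k..<m (Suc k)}. norm (f (x i)) powr p)"
      by (intro sum_mono)
    also have "\<dots> = (\<Sum>i\<in>{m 0..<m K}. norm (f (x i)) powr p)" by (rule sum_blocks[OF m])
    also have "\<dots> \<le> (\<Sum>i<m K. norm (f (x i)) powr p)" by (intro sum_mono2) auto
    also have "\<dots> \<le> M" by (rule M[OF f])
    finally show ?thesis .
  qed
  then show ?thesis unfolding weakly_summable_iff[OF X p] using z(1) by blast
qed

text \<open>
  Composition with \<open>T\<close> maps the dual unit ball of \<open>Y\<close> into a multiple of that of \<open>X\<close>. The factor
  \<open>C + 1\<close> instead of the bound \<open>C\<close> avoids a division by 0.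
\<close>

lemma operator_weakly_summable:
  assumes X: "normed_space X" and Y: "normed_space Y" and T: "operator X Y T" and p: "1 < p"
    and x: "x \<in> weakly_summable p X"
  shows "(\<lambda>n. T (x n)) \<in> weakly_summable p Y"
proof -
  interpret D: normed_space "dual X" by (rule normed_space_dual[OF X])
  obtain C where C: "0 \<le> C" "\<And>x. x \<in> carr X \<Longrightarrow> nrm Y (T x) \<le> C * nrm X x"
    by (rule operator_boundE[OF X Y T]) (rule that)
  obtain M where M: "\<And>f N. f \<in> unit_ball (dual X) \<Longrightarrow> (\<Sum>n<N. norm (f (x n)) powr p) \<le> M"
    and range: "range x \<subseteq> carr X"
    using x unfolding weakly_summable_iff[OF X p] by blast
  have Tx: "range (\<lambda>n. T (x n)) \<subseteq> carr Y" using range T by (auto simp: operator_def)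
  have "(\<Sum>n<N. norm (g (T (x n))) powr p) \<le> (C + 1) powr p * M" if g: "g \<in> unit_ball (dual Y)" for g N
  proof -
    define f where "f = smul (dual X) (of_real (1 / (C + 1))) (\<lambda>x\<in>carr X. g (T x))"
    have g': "g \<in> carr (dual Y)" using g by (simp add: unit_ball_def)
    have "f \<in> carr (dual X)"
      unfolding f_def by (intro D.smul_closed compose_dual[OF X Y T g'])
    moreover have "norm (f x) \<le> nrm X x" if x: "x \<in> carr X" for x
    proof -
      have "norm (g (T x)) \<le> nrm Y (T x)"
        using g x T by (auto simp: in_dual_unit_ball_iff[OF Y] operator_def)
      also have "\<dots> \<le> C * nrm X x" by (rule C(2)[OF x])
      also have "\<dots> \<le> (C + 1) * nrm X x"
        using normed_space.nrm_nonneg[OF X x] by (intro mult_right_mono) auto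
      finally show ?thesis
        using C(1) x by (simp add: f_def dual_simps norm_mult norm_divide field_simps del: of_real_add)
    qed
    ultimately have f: "f \<in> unit_ball (dual X)"
      by (simp add: in_dual_unit_ball_iff[OF X] in_dual_iff[OF X])
    have "norm (g (T (x n))) powr p = (C + 1) powr p * norm (f (x n)) powr p" for n
    proof -
      have "norm (g (T (x n))) = (C + 1) * norm (f (x n))"
        using C(1) range by (auto simp: f_def dual_simps norm_mult norm_divide image_subset_iff simp del: of_real_add)
      then show ?thesis using C(1) by (simp add: powr_mult)
    qed
    then have "(\<Sum>n<N. norm (g (T (x n))) powr p) = (C + 1) powr p * (\<Sum>n<N. norm (f (x n)) powr p)"
      by (simp add: sum_distrib_left)
    also have "\<dots> \<le> (C + 1) powr p * M" using M[OF f] by (intro mult_left_mono) auto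
    finally show ?thesis .
  qed
  with Tx show ?thesis unfolding weakly_summable_iff[OF Y p] by blast
qed

lemma tail_norm_le:
  assumes Y: "normed_space Y" and p: "1 < p" and y: "y \<in> weakly_summable p Y"
    and g: "g \<in> unit_ball (dual Y)"
  shows "tail_norm p (\<lambda>n. g (y n)) m \<le> (SUP g\<in>unit_ball (dual Y). tail_norm p (\<lambda>n. g (y n)) m)"
proof (rule cSUP_upper[OF g])
  obtain M where M: "\<And>f N. f \<in> unit_ball (dual Y) \<Longrightarrow> (\<Sum>n<N. norm (f (y n)) powr p) \<le> M"
    using y unfolding weakly_summable_iff[OF Y p] by blast
  have "tail_norm p (\<lambda>n. f (y n)) m \<le> M powr (1 / p)" if f: "f \<in> unit_ball (dual Y)" for f
  proof -
    have s: "summable (\<lambda>n. norm (f (y n)) powr p)"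
      using M[OF f] by (auto intro!: summableI_nonneg_bounded)
    have "(\<Sum>n. norm (f (y (n + m))) powr p) \<le> (\<Sum>n. norm (f (y n)) powr p)"
      using suminf_split_initial_segment[OF s, of m] by (simp add: sum_nonneg)
    also have "\<dots> \<le> M" using M[OF f] s by (intro suminf_le_const)
    finally show ?thesis
      unfolding tail_norm_def using p summable_ignore_initial_segment[OF s, of m]
      by (intro powr_mono2 suminf_nonneg) auto
  qed
  then show "bdd_above ((\<lambda>g. tail_norm p (\<lambda>n. g (y n)) m) ` unit_ball (dual Y))"
    by (rule bdd_aboveI2)
qed

text \<open>
  It suffices to control \<open>T (z k)\<close> for single indices instead of tails. If the tails of \<open>T (x n)\<close>
  stay above \<open>\<epsilon>\<close>, then from any index \<open>m\<close> on there is a finite stretch up to \<open>N m\<close> and a functional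
  \<open>G m\<close> for which the p-norm of that stretch exceeds \<open>\<epsilon>\<close>. Iterating \<open>N\<close> yields consecutive blocks.
  Combining the \<open>x i\<close> in each block with the extremal coefficients of Hoelder's inequality gives a
  weakly p-summable sequence \<open>z\<close> such that \<open>G (m k) (T (z k))\<close> is the p-norm of the k-th block.
\<close>

lemma unconditionally_convergingI:
  fixes X :: "('k::real_normed_field, 'a) nspace" and Y :: "('k, 'b) nspace"
  assumes X: "normed_space X" and Y: "normed_space Y" and T: "operator X Y T" and p: "1 < p"
    and small: "\<And>z \<epsilon>. z \<in> weakly_summable p X \<Longrightarrow> \<epsilon> > 0 \<Longrightarrow>
      \<exists>k. \<forall>g\<in>unit_ball (dual Y). norm (g (T (z k))) \<le> \<epsilon>"
  shows "unconditionally_converging p X Y T"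
  unfolding unconditionally_converging_def
proof (intro conjI T ballI)
  fix x assume x: "x \<in> weakly_summable p X"
  define q where "q = p / (p - 1)"
  have q: "1 < q" and pq: "1 / p + 1 / q = 1" using p by (simp_all add: q_def field_simps)
  have y: "(\<lambda>n. T (x n)) \<in> weakly_summable p Y"
    by (rule operator_weakly_summable[OF X Y T p x])
  define s where "s m = (SUP g\<in>unit_ball (dual Y). tail_norm p (\<lambda>n. g (T (x n))) m)" for m
  have nonempty: "unit_ball (dual Y) \<noteq> {}"
    using zero_in_unit_ball[OF normed_space_dual[OF Y]] by blast
  have s_nonneg: "0 \<le> s m" for m
  proof -
    obtain g where "g \<in> unit_ball (dual Y)" using nonempty by blast
    from tail_norm_le[OF Y p y this, of m] show ?thesis
      unfolding s_def tail_norm_def by (rule order_trans[rotated]) simp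
  qed
  have "\<exists>m0. \<forall>m\<ge>m0. s m \<le> \<epsilon>" if \<epsilon>: "\<epsilon> > 0" for \<epsilon>
  proof (rule ccontr)
    assume contra: "\<not> ?thesis"
    have "\<exists>m1 g. m0 \<le> m1 \<and> g \<in> unit_ball (dual Y) \<and> \<epsilon> powr p < (\<Sum>i\<in>{m0..<m1}. norm (g (T (x i))) powr p)" for m0
    proof -
      obtain m where m: "m \<ge> m0" "s m > \<epsilon>" using contra by (meson not_le)
      have "\<exists>g\<in>unit_ball (dual Y). \<epsilon> < tail_norm p (\<lambda>n. g (T (x n))) m"
        using m(2) cSUP_least[OF nonempty, of "\<lambda>g. tail_norm p (\<lambda>n. g (T (x n))) m" \<epsilon>]
        unfolding s_def by (meson not_le)
      then obtain g where g: "g \<in> unit_ball (dual Y)" "\<epsilon> < tail_norm p (\<lambda>n. g (T (x n))) m"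
        by blast
      let ?c = "\<lambda>i. norm (g (T (x i))) powr p"
      have summable: "summable (\<lambda>n. ?c (n + m))"
        using y g by (intro summable_ignore_initial_segment) (simp add: weakly_summable_def)
      have "\<epsilon> powr p < tail_norm p (\<lambda>n. g (T (x n))) m powr p"
        using g(2) \<epsilon> p by (intro powr_less_mono2) auto
      also have "\<dots> = (\<Sum>n. ?c (n + m))"
        using p suminf_nonneg[OF summable] by (simp add: tail_norm_def powr_powr)
      finally obtain N where "\<epsilon> powr p < (\<Sum>n<N. ?c (n + m))"
        using suminf_le_const[OF summable] by (meson not_le)
      also have "(\<Sum>n<N. ?c (n + m)) = (\<Sum>i\<in>{m..<m + N}. ?c i)"
        using sum.shift_bounds_nat_ivl[of ?c 0 m N] by (simp add: lessThan_atLeast0 add.commute)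
      also have "\<dots> \<le> (\<Sum>i\<in>{m0..<m + N}. ?c i)" using m by (intro sum_mono2) auto
      finally show ?thesis using g(1) m(1) by (intro exI[of _ "m + N"] exI[of _ g]) auto
    qed
    then obtain N G where N: "\<And>m. m \<le> N m" and G: "\<And>m. G m \<in> unit_ball (dual Y)"
      and big: "\<And>m. \<epsilon> powr p < (\<Sum>i\<in>{m..<N m}. norm (G m (T (x i))) powr p)"
      by metis
    define m where "m k = (N ^^ k) 0" for k
    have mSuc: "m (Suc k) = N (m k)" for k by (simp add: m_def)
    have "mono m" using N by (simp add: mono_iff_le_Suc mSuc)
    define P where "P k a \<longleftrightarrow> (\<Sum>i\<in>{m k..<m (Suc k)}. norm (a i) powr q) \<le> 1 \<and>
        (\<Sum>i\<in>{m k..<m (Suc k)}. a i * G (m k) (T (x i))) =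
        of_real ((\<Sum>i\<in>{m k..<m (Suc k)}. norm (G (m k) (T (x i))) powr p) powr (1 / p))" for k a
    have "\<exists>a. P k a" for k
    proof -
      have "0 \<le> \<epsilon> powr p" by simp
      then have "0 < (\<Sum>i\<in>{m k..<m (Suc k)}. norm (G (m k) (T (x i))) powr p)"
        unfolding mSuc using big by (rule le_less_trans)
      from holder_extremal[OF p q pq this] show ?thesis unfolding P_def by blast
    qed
    then obtain a where "\<And>k. P k (a k)" by metis
    then have a: "\<And>k. (\<Sum>i\<in>{m k..<m (Suc k)}. norm (a k i) powr q) \<le> 1"
      "\<And>k. (\<Sum>i\<in>{m k..<m (Suc k)}. a k i * G (m k) (T (x i))) =
        of_real ((\<Sum>i\<in>{m k..<m (Suc k)}. norm (G (m k) (T (x i))) powr p) powr (1 / p))"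
      by (simp_all add: P_def)
    have range: "x i \<in> carr X" for i using x by (auto simp: weakly_summable_def)
    define R where "R k z \<longleftrightarrow> z \<in> carr X \<and>
        (\<forall>f\<in>carr (dual X). f z = (\<Sum>i\<in>{m k..<m (Suc k)}. a k i * f (x i)))" for k z
    have "\<exists>z. R k z" for k
      using ex_combination[OF X, of "{m k..<m (Suc k)}" x "a k"] range unfolding R_def by auto
    then obtain z where "\<And>k. R k (z k)" by metis
    then have z: "\<And>k. z k \<in> carr X"
      "\<And>k f. f \<in> carr (dual X) \<Longrightarrow> f (z k) = (\<Sum>i\<in>{m k..<m (Suc k)}. a k i * f (x i))"
      by (simp_all add: R_def)
    have "z \<in> weakly_summable p X"
      by (rule weakly_summable_blocks[OF X p q pq x \<open>mono m\<close> a(1) z])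
    then obtain k where k: "\<And>g. g \<in> unit_ball (dual Y) \<Longrightarrow> norm (g (T (z k))) \<le> \<epsilon>"
      using small[OF _ \<epsilon>] by blast
    have G': "G (m k) \<in> carr (dual Y)" using G by (auto simp: unit_ball_def)
    define S where "S = (\<Sum>i\<in>{m k..<m (Suc k)}. norm (G (m k) (T (x i))) powr p)"
    have "G (m k) (T (z k)) = (\<lambda>x\<in>carr X. G (m k) (T x)) (z k)" using z(1) by simp
    also have "\<dots> = (\<Sum>i\<in>{m k..<m (Suc k)}. a k i * G (m k) (T (x i)))"
      unfolding z(2)[OF compose_dual[OF X Y T G']] using range by simp
    also have "\<dots> = of_real (S powr (1 / p))" by (simp only: a(2) S_def)
    finally have "S powr (1 / p) \<le> \<epsilon>" using k[OF G, of "m k"] by simp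
    moreover have "\<epsilon> powr p < S" using big[of "m k"] by (simp add: S_def mSuc)
    then have "(\<epsilon> powr p) powr (1 / p) < S powr (1 / p)" using p by (intro powr_less_mono2) auto
    then have "\<epsilon> < S powr (1 / p)" using \<epsilon> p by (simp add: powr_powr)
    ultimately show False by simp
  qed
  then have "s \<longlonglongrightarrow> 0"
    using s_nonneg by (intro LIMSEQ_I) (metis abs_of_nonneg diff_zero dense le_less_trans real_norm_def)
  then show "(\<lambda>n. T (x n)) \<in> unconditionally_summable p Y"
    using y by (simp add: unconditionally_summable_def s_def[abs_def])
qed

text \<open>
  The image of the dual unit ball of \<open>Y\<close> under the adjoint is relatively weakly compact by Gantmacher's
  theorem. That it is weakly p-limited gives the uniform smallness asked for by the preceding lemma.
\<close>

lemma weakly_limited_imp_unconditionally_converging: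
  fixes X :: "('k::{real_normed_field,real_inner,heine_borel}, 'a) nspace" and Y :: "('k, 'b) nspace"
  assumes X: "normed_space X" and Y: "normed_space Y" and p: "1 < p"
    and T: "weakly_compact_operator X Y T"
    and limited: "\<And>K. relatively_weakly_compact (dual X) K \<Longrightarrow> weakly_limited p X K"
  shows "unconditionally_converging p X Y T"
proof (rule unconditionally_convergingI[OF X Y _ p])
  show "operator X Y T" using T by (simp add: weakly_compact_operator_def)
  let ?K = "(\<lambda>g. \<lambda>x\<in>carr X. g (T x)) ` unit_ball (dual Y)"
  fix z and \<epsilon> :: real assume z: "z \<in> weakly_summable p X" and \<epsilon>: "\<epsilon> > 0"
  have "weakly_limited p X ?K"
    by (rule limited[OF adjoint_relatively_weakly_compact[OF X Y T]])
  then have "(\<lambda>n. SUP f\<in>?K. ennreal (norm (f (z n)))) \<longlonglongrightarrow> 0"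
    using z unfolding weakly_limited_def by blast
  moreover have "0 < ennreal \<epsilon>" using \<epsilon> by simp
  ultimately have "eventually (\<lambda>n. (SUP f\<in>?K. ennreal (norm (f (z n)))) < ennreal \<epsilon>) sequentially"
    by (rule order_tendstoD(2))
  then obtain k where k: "(SUP f\<in>?K. ennreal (norm (f (z k)))) < ennreal \<epsilon>"
    by (auto simp: eventually_sequentially)
  have "norm (g (T (z k))) \<le> \<epsilon>" if "g \<in> unit_ball (dual Y)" for g
  proof -
    have zk: "z k \<in> carr X" using z by (auto simp: weakly_summable_def)
    have "ennreal (norm ((\<lambda>x\<in>carr X. g (T x)) (z k))) \<le> (SUP f\<in>?K. ennreal (norm (f (z k))))"
      using that by (intro SUP_upper) blast
    then have "ennreal (norm (g (T (z k)))) \<le> ennreal \<epsilon>" using k zk by auto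
    then show ?thesis using \<epsilon> by (simp add: ennreal_le_iff)
  qed
  then show "\<exists>k. \<forall>g\<in>unit_ball (dual Y). norm (g (T (z k))) \<le> \<epsilon>" by blast
qed

section \<open>Boundedness of weakly compact sets of functionals\<close>

text \<open>
  By Baire's theorem one of the closed sets \<open>F n\<close>, on which all functionals of \<open>K\<close> are bounded by
  \<open>n\<close>, contains a ball. Differences of its points give a bound on a ball around 0.
\<close>

lemma uniform_boundedness:
  assumes X: "banach_space X" and K: "K \<subseteq> carr (dual X)"
    and pointwise: "\<And>x. x \<in> carr X \<Longrightarrow> \<exists>B. \<forall>f\<in>K. norm (f x) \<le> B"
  shows "\<exists>C. \<forall>f\<in>K. nrm (dual X) f \<le> C"
proof -
  have nX: "normed_space X" and complete: "Metric_space.mcomplete (carr X) (ndist X)"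
    using X by (auto simp: banach_space_def)
  interpret normed_space X by fact
  interpret M: Metric_space "carr X" "ndist X" by (rule Metric_space_ndist)
  define F where "F n = {x \<in> carr X. \<forall>f\<in>K. norm (f x) \<le> real n}" for n
  have closed: "closedin M.mtopology (F n)" for n
  proof -
    define pre where "pre f = {x \<in> topspace M.mtopology. f x \<in> cball 0 (real n)}" for f :: "'b \<Rightarrow> 'a"
    have "closedin M.mtopology (pre f)" if "f \<in> K" for f
    proof -
      have "f \<in> carr (dual X)" using K that by blast
      then have "continuous_map (norm_topology X) euclidean f"
        by (simp add: dual_def operator_def norm_topology_scalars)
      then have "continuous_map M.mtopology euclidean f" by (simp only: norm_topology_def)
      then show ?thesis unfolding pre_def by (rule closedin_continuous_map_preimage) simp
    qed
    then have "closedin M.mtopology (\<Inter>(insert (topspace M.mtopology) (pre ` K)))"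
      by (intro closedin_Inter) auto
    moreover have "\<Inter>(insert (topspace M.mtopology) (pre ` K)) = F n"
      by (auto simp: pre_def F_def)
    ultimately show ?thesis by simp
  qed
  have "\<Union>(range F) = carr X"
  proof
    show "carr X \<subseteq> \<Union>(range F)"
    proof
      fix x assume x: "x \<in> carr X"
      obtain B where B: "\<And>f. f \<in> K \<Longrightarrow> norm (f x) \<le> B" using pointwise[OF x] by blast
      obtain n where "B \<le> real n" using real_arch_simple by blast
      then have "x \<in> F n" using x B by (force simp: F_def)
      then show "x \<in> \<Union>(range F)" by blast
    qed
  qed (auto simp: F_def)
  moreover have "M.mtopology interior_of (carr X) = carr X"
    using interior_of_topspace[of M.mtopology] by simp
  ultimately have "M.mtopology interior_of \<Union>(range F) \<noteq> {}"
    using zero_closed by auto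
  then obtain n where "M.mtopology interior_of F n \<noteq> {}"
    using M.metric_Baire_category_alt[OF complete, of "range F"] closed by auto
  then obtain x0 where x0: "x0 \<in> M.mtopology interior_of F n" by blast
  then obtain r where r: "r > 0" "M.mball x0 r \<subseteq> M.mtopology interior_of F n"
    using openin_interior_of[of M.mtopology "F n"] unfolding M.openin_mtopology by blast
  have ball: "M.mball x0 r \<subseteq> F n" by (rule order_trans[OF r(2) interior_of_subset])
  have x0F: "x0 \<in> F n" by (rule subsetD[OF interior_of_subset x0])
  then have x0: "x0 \<in> carr X" by (simp add: F_def)
  have "nrm (dual X) f \<le> 4 * real n / r" if f: "f \<in> K" for f
  proof (rule dual_nrm_le[OF nX])
    have f': "f \<in> carr (dual X)" using K f by blast
    fix x assume "x \<in> unit_ball X"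
    then have x: "x \<in> carr X" "nrm X x \<le> 1" by (auto simp: unit_ball_def)
    let ?y = "smul X (of_real (r / 2)) x"
    have y: "?y \<in> carr X" using x(1) by (rule smul_closed)
    have "add X (add X ?y x0) (smul X (- 1) x0) = ?y"
      using x0 y by (simp add: add_assoc smul_closed add_minus add_zero)
    then have "ndist X (add X ?y x0) x0 = r / 2 * nrm X x"
      using x0 y x(1) r(1) by (simp add: ndist_def add_closed nrm_smul del: of_real_divide)
    also have "\<dots> \<le> r / 2 * 1" using x r(1) by (intro mult_left_mono) auto
    also have "\<dots> < r" using r(1) by simp
    finally have "add X ?y x0 \<in> F n"
      using ball x0 y by (auto simp: M.commute add_closed subset_iff)
    then have "norm (f (add X ?y x0)) \<le> real n" using f by (simp add: F_def)
    moreover have "f (add X ?y x0) = of_real (r / 2) * f x + f x0"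
      using x0 y x(1) by (simp only: dual_linear[OF nX f'])
    moreover have "norm (f x0) \<le> real n" using f x0F by (simp add: F_def)
    ultimately have "norm (of_real (r / 2) * f x :: 'a) \<le> 2 * real n"
      using norm_triangle_ineq4[of "of_real (r / 2) * f x + f x0" "f x0"] by simp
    then have "r / 2 * norm (f x) \<le> 2 * real n"
      using r(1) by (simp add: norm_mult del: of_real_divide)
    then show "norm (f x) \<le> 4 * real n / r" using r(1) by (simp add: field_simps)
  qed
  then show ?thesis by blast
qed

text \<open>
  The evaluation at a point of \<open>X\<close> is weakly continuous on the dual, hence bounded on a weakly
  compact set. So \<open>K\<close> is pointwise bounded.
\<close>

lemma relatively_weakly_compact_dual_bounded:
  assumes X: "banach_space X" and K: "relatively_weakly_compact (dual X) K"
  shows "\<exists>C. \<forall>f\<in>K. nrm (dual X) f \<le> C"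
proof (rule uniform_boundedness[OF X])
  have nX: "normed_space X" using X by (simp add: banach_space_def)
  have D: "normed_space (dual X)" by (rule normed_space_dual[OF nX])
  show sub: "K \<subseteq> carr (dual X)" using K by (simp add: relatively_weakly_compact_def)
  let ?W = "weak_topology (dual X)"
  fix x assume x: "x \<in> carr X"
  let ?ev = "\<lambda>f\<in>carr (dual X). f x"
  have "compactin euclidean (?ev ` (?W closure_of K))"
    using K continuous_map_weak_topology[OF D evaluation_in_bidual[OF nX x]]
    by (intro image_compactin) (auto simp: relatively_weakly_compact_def)
  then have "bounded (?ev ` (?W closure_of K))"
    unfolding compactin_euclidean_iff by (rule compact_imp_bounded)
  moreover have "K \<subseteq> ?W closure_of K"
    using sub normed_space.topspace_weak_topology[OF D] by (intro closure_of_subset) simp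
  ultimately have "bounded (?ev ` K)" by (meson bounded_subset image_mono)
  then show "\<exists>B. \<forall>f\<in>K. norm (f x) \<le> B" using sub by (auto simp: bounded_iff)
qed

section \<open>The Eberlein-Smulian theorem in dual spaces\<close>

lemma tendsto_fun_iff:
  fixes u :: "'i \<Rightarrow> 'a \<Rightarrow> 'b::topological_space"
  shows "(u \<longlongrightarrow> l) F \<longleftrightarrow> (\<forall>i. ((\<lambda>x. u x i) \<longlongrightarrow> l i) F)"
  using limitin_componentwise[of "\<lambda>_::'a. euclidean :: 'b topology" UNIV u l F]
  by (simp add: euclidean_product_topology)

text \<open>
  Two weak cluster points \<open>g\<close>, \<open>g'\<close> of a subsequence of \<open>f\<close> that agree on \<open>D\<close> are not distinguished by
  any \<open>\<phi>\<close> of the bidual ball. By Goldstine's theorem and the density of \<open>D\<close>, there are points \<open>d n\<close> of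
  \<open>D\<close> whose evaluations converge to \<open>\<phi>\<close> on every \<open>f i\<close>. A cluster point \<open>\<psi>\<close> of these evaluations in
  the bidual agrees with \<open>\<phi>\<close> on every \<open>f i\<close>, hence on \<open>g\<close> and \<open>g'\<close>, and it takes the same value at
  \<open>g\<close> and \<open>g'\<close> because these agree at every \<open>d n\<close>.
\<close>

lemma bidual_agree_on_cluster_points:
  fixes X :: "('k::{real_normed_field,euclidean_space}, 'a) nspace" and f :: "nat \<Rightarrow> 'a \<Rightarrow> 'k"
  assumes X: "normed_space X" and f: "\<And>n. f n \<in> carr (dual X)"
    and D: "D \<subseteq> unit_ball X"
    and dense: "(\<lambda>x i. f i x) ` unit_ball X \<subseteq> closure ((\<lambda>x i. f i x) ` D)"
    and g: "g \<in> carr (dual X)" "G \<noteq> bot" "\<And>\<phi>. \<phi> \<in> carr (dual (dual X)) \<Longrightarrow> ((\<lambda>j. \<phi> (f (r j))) \<longlongrightarrow> \<phi> g) G"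
    and g': "g' \<in> carr (dual X)" "G' \<noteq> bot" "\<And>\<phi>. \<phi> \<in> carr (dual (dual X)) \<Longrightarrow> ((\<lambda>j. \<phi> (f (r j))) \<longlongrightarrow> \<phi> g') G'"
    and agree: "\<And>x. x \<in> D \<Longrightarrow> g x = g' x"
    and \<phi>: "\<phi> \<in> unit_ball (dual (dual X))"
  shows "\<phi> g = \<phi> g'"
proof -
  let ?P = "\<lambda>x i. f i x"
  have nD: "normed_space (dual X)" using X by (rule normed_space_dual)
  obtain F where F: "F \<noteq> bot" "eventually (\<lambda>x. x \<in> unit_ball X) F"
    "\<And>h. h \<in> carr (dual X) \<Longrightarrow> (h \<longlongrightarrow> \<phi> h) F"
    using goldstine[OF X \<phi>] by blast
  have "(\<lambda>i. \<phi> (f i)) \<in> closure (?P ` D)"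
  proof (rule Lim_in_closed_set[OF closed_closure])
    show "eventually (\<lambda>x. ?P x \<in> closure (?P ` D)) F"
      using F(2) by eventually_elim (use dense in blast)
    show "(?P \<longlongrightarrow> (\<lambda>i. \<phi> (f i))) F"
      unfolding tendsto_fun_iff using F(3) f by blast
  qed (rule F(1))
  then obtain u where u: "\<And>n. u n \<in> ?P ` D" "u \<longlonglongrightarrow> (\<lambda>i. \<phi> (f i))"
    unfolding closure_sequential by blast
  from u(1) have "\<exists>x\<in>D. u n = ?P x" for n by blast
  then obtain d where d: "\<And>n. d n \<in> D" "\<And>n. u n = ?P (d n)" by metis
  have \<phi>f: "(\<lambda>n. f i (d n)) \<longlonglongrightarrow> \<phi> (f i)" for i
    using u(2) unfolding tendsto_fun_iff by (simp add: d(2))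
  have dball: "d n \<in> unit_ball X" "d n \<in> carr X" for n
    using d(1) D by (auto simp: unit_ball_def subset_iff)
  have "eventually (\<lambda>n. (\<lambda>h\<in>carr (dual X). h (d n)) \<in> unit_ball (dual (dual X))) sequentially"
    using evaluation_in_bidual_unit_ball[OF X dball(1)] by simp
  from compactin_cluster_point[OF compactin_dual_unit_ball[OF nD] sequentially_bot this]
  obtain \<psi> H where \<psi>: "\<psi> \<in> unit_ball (dual (dual X))" and H: "H \<le> sequentially" "H \<noteq> bot"
    and lim: "limitin (pointwise_topology (dual X)) (\<lambda>n. \<lambda>h\<in>carr (dual X). h (d n)) \<psi> H"
    by blast
  have \<psi>': "\<psi> \<in> carr (dual (dual X))" and \<phi>': "\<phi> \<in> carr (dual (dual X))"
    using \<phi> \<psi> by (auto simp: unit_ball_def)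
  have lim\<psi>: "((\<lambda>n. h (d n)) \<longlongrightarrow> \<psi> h) H" if h: "h \<in> carr (dual X)" for h
    using continuous_map_limit[OF continuous_map_product_projection[OF h] lim] h by (simp add: o_def)
  have eq_f: "\<psi> (f i) = \<phi> (f i)" for i
    using tendsto_unique[OF H(2) lim\<psi>[OF f] tendsto_mono[OF H(1) \<phi>f]] .
  have "\<phi> g = \<psi> g"
    using tendsto_unique[OF g(2) g(3)[OF \<phi>']] g(3)[OF \<psi>'] by (simp add: eq_f)
  also have "\<dots> = \<psi> g'"
    using tendsto_unique[OF H(2) lim\<psi>[OF g(1)]] lim\<psi>[OF g'(1)] agree[OF d(1)] by simp
  also have "\<dots> = \<phi> g'"
    using tendsto_unique[OF g'(2) g'(3)[OF \<phi>']] g'(3)[OF \<psi>'] by (simp add: eq_f)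
  finally show ?thesis .
qed

text \<open>
  The sequences \<open>(f i x)\<^sub>i\<close> for \<open>x\<close> in the unit ball form a subset of a separable metrizable space,
  so a countable set \<open>D\<close> of points \<open>x\<close> yields a dense part. A diagonal argument gives a subsequence
  that converges at every point of \<open>D\<close>. All its weak cluster points agree on \<open>D\<close>, so by the preceding
  lemma it has only one, and in a relatively weakly compact set it must converge to it.
\<close>

lemma eberlein_smulian_dual:
  fixes X :: "('k::{real_normed_field,euclidean_space}, 'a) nspace" and f :: "nat \<Rightarrow> 'a \<Rightarrow> 'k"
  assumes X: "normed_space X" and K: "relatively_weakly_compact (dual X) K"
    and bounded: "\<And>f. f \<in> K \<Longrightarrow> nrm (dual X) f \<le> C" and fK: "\<And>n. f n \<in> K"
  obtains r g where "strict_mono r" "g \<in> carr (dual X)"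
    "\<And>\<phi>. \<phi> \<in> carr (dual (dual X)) \<Longrightarrow> (\<lambda>j. \<phi> (f (r j))) \<longlonglongrightarrow> \<phi> g"
proof -
  let ?P = "\<lambda>x i. f i x"
  have nD: "normed_space (dual X)" and nDD: "normed_space (dual (dual X))"
    using X by (auto intro: normed_space_dual)
  have f: "f n \<in> carr (dual X)" for n
    using fK K by (auto simp: relatively_weakly_compact_def)
  obtain T where T: "countable T" "T \<subseteq> ?P ` unit_ball X" "?P ` unit_ball X \<subseteq> closure T"
    by (rule separable)
  then obtain D where D: "countable D" "D \<subseteq> unit_ball X" "T = ?P ` D"
    using countable_subset_image[of T ?P "unit_ball X"] by blast
  have "norm (f n x) \<le> C" if "x \<in> D" for n x
    using dual_apply_le_unit_ball[OF X f] bounded[OF fK] D(2) that by (meson order_trans subsetD)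
  then obtain r where r: "strict_mono r" "\<And>x. x \<in> D \<Longrightarrow> \<exists>l. (\<lambda>n. f (r n) x) \<longlonglongrightarrow> l"
    using function_convergent_subsequence[OF D(1), of f C] by metis
  have unique: "\<phi> g = \<phi> g'"
    if \<phi>: "\<phi> \<in> carr (dual (dual X))"
      and g: "g \<in> carr (dual X)" "G \<le> sequentially" "G \<noteq> bot"
        "\<And>\<phi>. \<phi> \<in> carr (dual (dual X)) \<Longrightarrow> ((\<lambda>j. \<phi> (f (r j))) \<longlongrightarrow> \<phi> g) G"
      and g': "g' \<in> carr (dual X)" "G' \<le> sequentially" "G' \<noteq> bot"
        "\<And>\<phi>. \<phi> \<in> carr (dual (dual X)) \<Longrightarrow> ((\<lambda>j. \<phi> (f (r j))) \<longlongrightarrow> \<phi> g') G'"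
    for \<phi> g G g' G'
  proof -
    have lim: "h x = l" if "(\<lambda>n. f (r n) x) \<longlonglongrightarrow> l" "x \<in> D"
      "h \<in> carr (dual X)" "H \<le> sequentially" "H \<noteq> bot"
      "\<And>\<phi>. \<phi> \<in> carr (dual (dual X)) \<Longrightarrow> ((\<lambda>j. \<phi> (f (r j))) \<longlongrightarrow> \<phi> h) H" for h x l H
    proof -
      have x: "x \<in> carr X" using that(2) D(2) by (auto simp: unit_ball_def)
      have "((\<lambda>j. f (r j) x) \<longlongrightarrow> h x) H"
        using that(6)[OF evaluation_in_bidual[OF X x]] f that(3) by simp
      then show ?thesis using tendsto_unique[OF that(5) _ tendsto_mono[OF that(4,1)]] by blast
    qed
    have agree: "g x = g' x" if "x \<in> D" for x
      using r(2)[OF that] lim[OF _ that g] lim[OF _ that g'] by metis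
    obtain c \<psi> where \<psi>: "\<psi> \<in> unit_ball (dual (dual X))" and \<phi>\<psi>: "\<phi> = smul (dual (dual X)) (of_real c) \<psi>"
      using ex_scaled_unit_ball[OF nDD \<phi>] by metis
    have "\<psi> g = \<psi> g'"
      by (rule bidual_agree_on_cluster_points[OF X f D(2) T(3)[unfolded D(3)] g(1,3,4) g'(1,3,4) agree \<psi>])
    then show ?thesis unfolding \<phi>\<psi> by (simp add: dual_simps g(1) g'(1))
  qed
  have cluster: "\<exists>g G. g \<in> carr (dual X) \<and> G \<le> F \<and> G \<noteq> bot \<and>
      (\<forall>\<phi>\<in>carr (dual (dual X)). ((\<lambda>j. \<phi> (f (r j))) \<longlongrightarrow> \<phi> g) G)" if "F \<noteq> bot" for F
    using relatively_weakly_compact_cluster_point[OF nD K that, of "\<lambda>j. f (r j)"] fK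
    by (smt (verit) always_eventually)
  obtain g G where g: "g \<in> carr (dual X)" "G \<le> sequentially" "G \<noteq> bot"
    "\<And>\<phi>. \<phi> \<in> carr (dual (dual X)) \<Longrightarrow> ((\<lambda>j. \<phi> (f (r j))) \<longlongrightarrow> \<phi> g) G"
    using cluster[OF sequentially_bot] by blast
  have "(\<lambda>j. \<phi> (f (r j))) \<longlonglongrightarrow> \<phi> g" if \<phi>: "\<phi> \<in> carr (dual (dual X))" for \<phi>
  proof (rule ccontr)
    assume "\<not> ?thesis"
    then obtain \<epsilon> where \<epsilon>: "\<epsilon> > 0" "\<not> eventually (\<lambda>j. dist (\<phi> (f (r j))) (\<phi> g) < \<epsilon>) sequentially"
      by (auto simp: tendsto_iff)
    \<comment> \<open>A second cluster point, taken along the indices far from \<open>g\<close>, contradicts uniqueness.\<close>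
    let ?far = "{j. \<epsilon> \<le> dist (\<phi> (f (r j))) (\<phi> g)}"
    let ?F = "inf sequentially (principal ?far)"
    have "?F \<noteq> bot"
      using \<epsilon>(2) by (simp add: trivial_limit_def eventually_inf_principal not_le)
    from cluster[OF this] obtain g' G' where g': "g' \<in> carr (dual X)" "G' \<le> ?F" "G' \<noteq> bot"
      "\<And>\<phi>. \<phi> \<in> carr (dual (dual X)) \<Longrightarrow> ((\<lambda>j. \<phi> (f (r j))) \<longlongrightarrow> \<phi> g') G'"
      by blast
    have "G' \<le> sequentially" using g'(2) by simp
    from unique[OF \<phi> g g'(1) this g'(3,4)] have "((\<lambda>j. \<phi> (f (r j))) \<longlongrightarrow> \<phi> g) G'"
      using g'(4)[OF \<phi>] by simp
    then have "eventually (\<lambda>j. dist (\<phi> (f (r j))) (\<phi> g) < \<epsilon>) G'"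
      using \<epsilon>(1) by (simp add: tendsto_iff)
    moreover have "eventually (\<lambda>j. \<epsilon> \<le> dist (\<phi> (f (r j))) (\<phi> g)) G'"
      using g'(2) by (simp add: le_principal)
    ultimately have "eventually (\<lambda>j. False) G'" by eventually_elim simp
    then show False using g'(3) by (simp add: trivial_limit_def)
  qed
  with r(1) g(1) show thesis by (rule that)
qed

section \<open>The space of null sequences\<close>

definition null_sequences :: "(nat \<Rightarrow> 'k::real_normed_field) set" where
  "null_sequences = {s. s \<longlonglongrightarrow> 0}"

text \<open>
  The space \<open>c\<^sub>0\<close>, carried over into the universe \<open>'u\<close> along \<open>e\<close>. Only injective \<open>e\<close> are of interest.
  The supremum in the norm is finite because null sequences are bounded.
\<close>

definition c0_copy :: "((nat \<Rightarrow> 'k::real_normed_field) \<Rightarrow> 'u) \<Rightarrow> ('k, 'u) nspace" where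
  "c0_copy e =
    \<lparr>carr = e ` null_sequences,
     add = (\<lambda>u v. e (\<lambda>n. inv e u n + inv e v n)),
     zero = e (\<lambda>_. 0),
     smul = (\<lambda>c u. e (\<lambda>n. c * inv e u n)),
     nrm = (\<lambda>u. SUP n. norm (inv e u n))\<rparr>"

lemma c0_copy_simps:
  assumes "inj e"
  shows "e s \<in> carr (c0_copy e) \<longleftrightarrow> s \<in> null_sequences"
    and "add (c0_copy e) (e s) (e t) = e (\<lambda>n. s n + t n)"
    and "zero (c0_copy e) = e (\<lambda>_. 0)"
    and "smul (c0_copy e) c (e s) = e (\<lambda>n. c * s n)"
    and "nrm (c0_copy e) (e s) = (SUP n. norm (s n))"
  using assms by (auto simp: c0_copy_def inj_image_mem_iff)

lemma in_c0_copyE: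
  assumes "u \<in> carr (c0_copy e)"
  obtains s where "u = e s" "s \<in> null_sequences"
  using assms by (auto simp: c0_copy_def)

lemma null_sequences_bdd:
  assumes "s \<in> null_sequences"
  shows "bdd_above (range (\<lambda>n. norm (s n)))"
proof -
  have "Bseq s" using assms by (auto simp: null_sequences_def intro: convergent_imp_Bseq convergentI)
  then obtain K where "\<And>n. norm (s n) \<le> K" by (auto simp: Bseq_def)
  then show ?thesis by (rule bdd_aboveI2)
qed

lemma c0_copy_nrm_ge:
  assumes "inj e" "s \<in> null_sequences"
  shows "norm (s n) \<le> nrm (c0_copy e) (e s)"
  unfolding c0_copy_simps[OF assms(1)] by (intro cSUP_upper null_sequences_bdd assms) simp

lemma c0_copy_nrm_le:
  assumes "inj e" "\<And>n. norm (s n) \<le> C"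
  shows "nrm (c0_copy e) (e s) \<le> C"
  unfolding c0_copy_simps[OF assms(1)] by (intro cSUP_least assms) simp

lemma null_sequences_closed:
  "(\<lambda>_. 0) \<in> null_sequences"
  "s \<in> null_sequences \<Longrightarrow> t \<in> null_sequences \<Longrightarrow> (\<lambda>n. s n + t n) \<in> null_sequences"
  "s \<in> null_sequences \<Longrightarrow> (\<lambda>n. c * s n) \<in> null_sequences"
  "(\<lambda>n. if n < N then t n else 0) \<in> null_sequences"
proof -
  show "(\<lambda>n. if n < N then t n else 0) \<in> null_sequences"
    unfolding null_sequences_def mem_Collect_eq
    by (rule tendsto_eventually) (auto simp: eventually_sequentially intro!: exI[of _ N])
qed (auto simp: null_sequences_def intro: tendsto_eq_intros)

lemma normed_space_c0_copy:
  assumes e: "inj e"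
  shows "normed_space (c0_copy e)"
proof
  note simps = c0_copy_simps[OF e]
  show "nrm (c0_copy e) (smul (c0_copy e) c x) = norm c * nrm (c0_copy e) x"
    if x: "x \<in> carr (c0_copy e)" for c x
  proof -
    obtain s where s: "x = e s" "s \<in> null_sequences" using x by (rule in_c0_copyE)
    have le: "nrm (c0_copy e) (e (\<lambda>n. d * t n)) \<le> norm d * nrm (c0_copy e) (e t)"
      if "t \<in> null_sequences" for d t
      by (intro c0_copy_nrm_le[OF e]) (auto simp: norm_mult intro!: mult_left_mono c0_copy_nrm_ge[OF e that])
    show ?thesis
    proof (cases "c = 0")
      case True
      then show ?thesis by (simp add: simps s)
    next
      case False
      have "nrm (c0_copy e) (e (\<lambda>n. (1 / c) * (c * s n))) \<le> norm (1 / c) * nrm (c0_copy e) (e (\<lambda>n. c * s n))"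
        by (intro le null_sequences_closed s)
      then have "norm c * nrm (c0_copy e) (e s) \<le> nrm (c0_copy e) (e (\<lambda>n. c * s n))"
        using False by (simp add: norm_divide field_simps)
      with le[OF s(2), of c] show ?thesis unfolding s(1) simps(4) by simp
    qed
  qed
  show "nrm (c0_copy e) x = 0 \<longleftrightarrow> x = zero (c0_copy e)" if x: "x \<in> carr (c0_copy e)" for x
  proof -
    obtain s where s: "x = e s" "s \<in> null_sequences" using x by (rule in_c0_copyE)
    show ?thesis
    proof
      assume "nrm (c0_copy e) x = 0"
      then have "s = (\<lambda>_. 0)" using c0_copy_nrm_ge[OF e s(2)] s(1) by auto
      then show "x = zero (c0_copy e)" by (simp add: s simps)
    qed (simp add: simps)
  qed
  show "0 \<le> nrm (c0_copy e) x" if "x \<in> carr (c0_copy e)" for x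
    using that c0_copy_nrm_ge[OF e] by (metis in_c0_copyE norm_ge_zero order_trans)
  show "nrm (c0_copy e) (add (c0_copy e) x y) \<le> nrm (c0_copy e) x + nrm (c0_copy e) y"
    if xy: "x \<in> carr (c0_copy e)" "y \<in> carr (c0_copy e)" for x y
  proof -
    obtain s where s: "x = e s" "s \<in> null_sequences" using xy(1) by (rule in_c0_copyE)
    obtain t where t: "y = e t" "t \<in> null_sequences" using xy(2) by (rule in_c0_copyE)
    show ?thesis
      unfolding s(1) t(1) simps(2)
      by (intro c0_copy_nrm_le[OF e] norm_triangle_le add_mono c0_copy_nrm_ge[OF e] s t)
  qed
  show "\<exists>y\<in>carr (c0_copy e). add (c0_copy e) x y = zero (c0_copy e)" if x: "x \<in> carr (c0_copy e)" for x
  proof -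
    obtain s where s: "x = e s" "s \<in> null_sequences" using x by (rule in_c0_copyE)
    have "e (\<lambda>n. - 1 * s n) \<in> carr (c0_copy e)"
      unfolding simps(1) by (rule null_sequences_closed(3)[OF s(2)])
    then show ?thesis by (rule bexI[rotated]) (simp add: s simps)
  qed
qed (auto elim!: in_c0_copyE simp: c0_copy_simps[OF e] null_sequences_closed algebra_simps)

lemma banach_space_c0_copy:
  fixes e :: "(nat \<Rightarrow> 'k::{real_normed_field,banach}) \<Rightarrow> 'u"
  assumes e: "inj e"
  shows "banach_space (c0_copy e)"
  unfolding banach_space_def
proof (intro conjI normed_space_c0_copy[OF e])
  note simps = c0_copy_simps[OF e]
  interpret normed_space "c0_copy e" by (rule normed_space_c0_copy[OF e])
  interpret M: Metric_space "carr (c0_copy e)" "ndist (c0_copy e)" by (rule Metric_space_ndist)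
  have ndist: "ndist (c0_copy e) (e s) (e t) = nrm (c0_copy e) (e (\<lambda>n. s n - t n))"
    if "s \<in> null_sequences" "t \<in> null_sequences" for s t
    using that by (simp add: ndist_def simps)
  have diff: "(\<lambda>n. s n - t n) \<in> null_sequences"
    if "s \<in> null_sequences" "t \<in> null_sequences" for s t :: "nat \<Rightarrow> 'k"
    using tendsto_diff[of s 0 _ t 0] that by (simp add: null_sequences_def)
  show "M.mcomplete"
    unfolding M.mcomplete_def
  proof (intro allI impI)
    fix \<sigma> assume \<sigma>: "M.MCauchy \<sigma>"
    define s where "s n = inv e (\<sigma> n)" for n
    have s: "\<sigma> n = e (s n)" "s n \<in> null_sequences" for n
    proof -
      have "\<sigma> n \<in> carr (c0_copy e)" using \<sigma> by (auto simp: M.MCauchy_def)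
      then obtain t where "\<sigma> n = e t" "t \<in> null_sequences" by (rule in_c0_copyE)
      then show "\<sigma> n = e (s n)" "s n \<in> null_sequences" using e by (auto simp: s_def)
    qed
    have close: "\<exists>N. \<forall>n\<ge>N. \<forall>m\<ge>N. \<forall>k. norm (s n k - s m k) < \<epsilon>" if \<epsilon>: "\<epsilon> > 0" for \<epsilon>
    proof -
      obtain N where N: "\<And>n m. N \<le> n \<Longrightarrow> N \<le> m \<Longrightarrow> ndist (c0_copy e) (\<sigma> n) (\<sigma> m) < \<epsilon>"
        using \<sigma> \<epsilon> unfolding M.MCauchy_def by blast
      have "norm (s n k - s m k) < \<epsilon>" if nm: "N \<le> n" "N \<le> m" for n m k
      proof -
        have "norm (s n k - s m k) \<le> nrm (c0_copy e) (e (\<lambda>k. s n k - s m k))"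
          by (rule c0_copy_nrm_ge[OF e diff[OF s(2) s(2)]])
        then show ?thesis using N[OF nm] ndist[OF s(2) s(2), of n m] by (simp add: s(1))
      qed
      then show ?thesis by blast
    qed
    have "Cauchy (\<lambda>n. s n k)" for k
      unfolding Cauchy_iff using close by meson
    then have "\<exists>l. (\<lambda>n. s n k) \<longlonglongrightarrow> l" for k
      using Cauchy_convergent convergent_def by blast
    then obtain l where l: "\<And>k. (\<lambda>n. s n k) \<longlonglongrightarrow> l k" by metis
    have unif: "\<exists>N. \<forall>n\<ge>N. \<forall>k. norm (s n k - l k) \<le> \<epsilon>" if \<epsilon>: "\<epsilon> > 0" for \<epsilon>
    proof -
      obtain N where N: "\<And>n m k. N \<le> n \<Longrightarrow> N \<le> m \<Longrightarrow> norm (s n k - s m k) < \<epsilon>"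
        using close[OF \<epsilon>] by blast
      have "norm (s n k - l k) \<le> \<epsilon>" if n: "N \<le> n" for n k
      proof (rule Lim_bounded)
        show "(\<lambda>m. norm (s n k - s m k)) \<longlonglongrightarrow> norm (s n k - l k)"
          by (intro tendsto_intros l)
        show "\<forall>m\<ge>N. norm (s n k - s m k) \<le> \<epsilon>" using N[OF n] less_imp_le by blast
      qed
      then show ?thesis by blast
    qed
    have "l \<in> null_sequences"
      unfolding null_sequences_def mem_Collect_eq
    proof (rule LIMSEQ_I)
      fix \<epsilon> :: real assume \<epsilon>: "\<epsilon> > 0"
      then obtain N where N: "\<And>k. norm (s N k - l k) \<le> \<epsilon> / 2"
        using unif[of "\<epsilon> / 2"] by auto
      have "s N \<longlonglongrightarrow> 0" using s(2) by (simp add: null_sequences_def)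
      then obtain k0 where k0: "\<And>k. k \<ge> k0 \<Longrightarrow> norm (s N k) < \<epsilon> / 2"
        using \<epsilon> LIMSEQ_D[of "s N" 0 "\<epsilon> / 2"] by auto
      have "norm (l k - 0) < \<epsilon>" if "k \<ge> k0" for k
        using k0[OF that] N[of k] norm_triangle_sub[of "l k" "s N k"] by (simp add: norm_minus_commute)
      then show "\<exists>k0. \<forall>k\<ge>k0. norm (l k - 0) < \<epsilon>" by blast
    qed
    then have "limitin M.mtopology \<sigma> (e l) sequentially"
      unfolding M.limitin_metric
    proof (intro conjI allI impI)
      fix \<epsilon> :: real assume l0: "l \<in> null_sequences" and \<epsilon>: "\<epsilon> > 0"
      obtain N where N: "\<And>n k. N \<le> n \<Longrightarrow> norm (s n k - l k) \<le> \<epsilon> / 2"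
        using unif[of "\<epsilon> / 2"] \<epsilon> by auto
      have "ndist (c0_copy e) (\<sigma> n) (e l) < \<epsilon>" if "N \<le> n" for n
      proof -
        have "nrm (c0_copy e) (e (\<lambda>k. s n k - l k)) \<le> \<epsilon> / 2"
          by (intro c0_copy_nrm_le[OF e] N that)
        then show ?thesis unfolding s(1) ndist[OF s(2) l0] using \<epsilon> by simp
      qed
      then show "eventually (\<lambda>n. \<sigma> n \<in> carr (c0_copy e) \<and> ndist (c0_copy e) (\<sigma> n) (e l) < \<epsilon>) sequentially"
        using s by (auto simp: eventually_sequentially simps)
    qed (simp add: simps)
    then show "\<exists>x. limitin M.mtopology \<sigma> x sequentially" by blast
  qed
qed

definition unit_vector :: "nat \<Rightarrow> nat \<Rightarrow> 'k::real_normed_field" where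
  "unit_vector k n = (if n = k then 1 else 0)"

lemma unit_vector_null: "unit_vector k \<in> null_sequences"
  unfolding null_sequences_def unit_vector_def mem_Collect_eq
  by (rule tendsto_eventually) (auto simp: eventually_sequentially intro!: exI[of _ "Suc k"])

lemma c0_copy_coordinate:
  assumes e: "inj e"
  shows "(\<lambda>u\<in>carr (c0_copy e). inv e u n) \<in> unit_ball (dual (c0_copy e))"
  unfolding in_dual_unit_ball_iff[OF normed_space_c0_copy[OF e]]
proof (intro conjI ballI allI)
  show "norm ((\<lambda>u\<in>carr (c0_copy e). inv e u n) x) \<le> nrm (c0_copy e) x" if "x \<in> carr (c0_copy e)" for x
    using that by (elim in_c0_copyE) (simp add: e c0_copy_nrm_ge c0_copy_simps(1))
qed (auto elim!: in_c0_copyE simp: e inj_eq[OF e] c0_copy_simps null_sequences_closed)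

lemma c0_copy_functional_truncated:
  assumes e: "inj e" and \<mu>: "\<mu> \<in> carr (dual (c0_copy e))"
  shows "\<mu> (e (\<lambda>n. if n < N then s n else 0)) = (\<Sum>k<N. s k * \<mu> (e (unit_vector k)))"
proof (induction N)
  case 0
  note n = normed_space_c0_copy[OF e]
  have "\<mu> (smul (c0_copy e) 0 (zero (c0_copy e))) = 0 * \<mu> (zero (c0_copy e))"
    by (rule dual_linear(2)[OF n \<mu> normed_space.zero_closed[OF n]])
  then show ?case by (simp add: c0_copy_simps[OF e])
next
  case (Suc N)
  let ?t = "\<lambda>N n. if n < N then s n else 0"
  note n = normed_space_c0_copy[OF e]
  have t: "e (?t N) \<in> carr (c0_copy e)" and unit: "e (unit_vector N) \<in> carr (c0_copy e)"
    by (simp_all add: c0_copy_simps(1)[OF e] null_sequences_closed unit_vector_null)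
  have "e (?t (Suc N)) = add (c0_copy e) (e (?t N)) (smul (c0_copy e) (s N) (e (unit_vector N)))"
    by (auto simp: c0_copy_simps[OF e] unit_vector_def less_Suc_eq intro!: arg_cong[of _ _ e] ext)
  also have "\<mu> \<dots> = \<mu> (e (?t N)) + \<mu> (smul (c0_copy e) (s N) (e (unit_vector N)))"
    by (rule dual_linear(1)[OF n \<mu> t normed_space.smul_closed[OF n unit]])
  also have "\<mu> (smul (c0_copy e) (s N) (e (unit_vector N))) = s N * \<mu> (e (unit_vector N))"
    by (rule dual_linear(2)[OF n \<mu> unit])
  finally show ?case using Suc by simp
qed

text \<open>
  The dual of \<open>c\<^sub>0\<close> is \<open>l\<^sub>1\<close>: the functional attains the partial sum of the absolute values at a
  finite sequence of scalars of norm at most 1 that undo the phases.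
\<close>

lemma c0_copy_functional_summable:
  assumes e: "inj e" and \<mu>: "\<mu> \<in> carr (dual (c0_copy e))"
  shows "summable (\<lambda>k. norm (\<mu> (e (unit_vector k))))"
proof (rule summableI_nonneg_bounded)
  fix N
  let ?c = "\<lambda>k. \<mu> (e (unit_vector k))"
  \<comment> \<open>Where \<open>?c k\<close> vanishes, the quotient is 0, which does no harm.\<close>
  define s where "s k = of_real (norm (?c k)) / ?c k" for k
  let ?u = "e (\<lambda>n. if n < N then s n else 0)"
  have u: "?u \<in> carr (c0_copy e)" by (simp add: c0_copy_simps[OF e] null_sequences_closed)
  have "\<mu> ?u = (\<Sum>k<N. of_real (norm (?c k)))"
    unfolding c0_copy_functional_truncated[OF e \<mu>] by (intro sum.cong) (auto simp: s_def)
  then have "(\<Sum>k<N. norm (?c k)) = norm (\<mu> ?u)"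
    by (simp add: sum_nonneg flip: of_real_sum)
  also have "\<dots> \<le> nrm (dual (c0_copy e)) \<mu> * nrm (c0_copy e) ?u"
    by (rule dual_apply_le[OF normed_space_c0_copy[OF e] \<mu> u])
  also have "\<dots> \<le> nrm (dual (c0_copy e)) \<mu> * 1"
    by (intro mult_left_mono c0_copy_nrm_le[OF e] dual_nrm_nonneg[OF normed_space_c0_copy[OF e] \<mu>])
      (auto simp: s_def norm_divide)
  finally show "(\<Sum>k<N. norm (?c k)) \<le> nrm (dual (c0_copy e)) \<mu>" by simp
qed simp

text \<open>
  The truncations of a null sequence converge to it in norm.
\<close>

lemma c0_copy_functional_sums:
  assumes e: "inj e" and \<mu>: "\<mu> \<in> carr (dual (c0_copy e))" and s: "s \<in> null_sequences"
  shows "(\<lambda>k. s k * \<mu> (e (unit_vector k))) sums \<mu> (e s)"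
proof -
  note n = normed_space_c0_copy[OF e]
  have rest: "norm (\<mu> (e s) - (\<Sum>k<N. s k * \<mu> (e (unit_vector k)))) \<le> nrm (dual (c0_copy e)) \<mu> * \<epsilon>"
    if \<epsilon>: "\<And>k. k \<ge> N \<Longrightarrow> norm (s k) \<le> \<epsilon>" for N \<epsilon>
  proof -
    define t where "t = (\<lambda>n. if n < N then s n else 0)"
    define r where "r n = s n - t n" for n
    have t: "t \<in> null_sequences" unfolding t_def by (rule null_sequences_closed)
    have r: "r \<in> null_sequences"
      using tendsto_diff[of s 0 _ t 0] s t by (simp add: null_sequences_def r_def[abs_def])
    have "e s = add (c0_copy e) (e t) (e r)" by (simp add: c0_copy_simps[OF e] r_def)
    then have "\<mu> (e s) = \<mu> (e t) + \<mu> (e r)"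
      using r t by (simp only: dual_linear[OF n \<mu>] c0_copy_simps(1)[OF e])
    moreover have "\<mu> (e t) = (\<Sum>k<N. s k * \<mu> (e (unit_vector k)))"
      unfolding t_def by (rule c0_copy_functional_truncated[OF e \<mu>])
    ultimately have "\<mu> (e s) - (\<Sum>k<N. s k * \<mu> (e (unit_vector k))) = \<mu> (e r)" by simp
    also have "norm \<dots> \<le> nrm (dual (c0_copy e)) \<mu> * nrm (c0_copy e) (e r)"
      using r by (intro dual_apply_le[OF n \<mu>]) (simp only: c0_copy_simps[OF e])
    also have "\<dots> \<le> nrm (dual (c0_copy e)) \<mu> * \<epsilon>"
    proof (intro mult_left_mono c0_copy_nrm_le[OF e] dual_nrm_nonneg[OF n \<mu>])
      have "0 \<le> \<epsilon>" using \<epsilon>[of N] norm_ge_zero[of "s N"] by linarith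
      then show "norm (r k) \<le> \<epsilon>" for k using \<epsilon>[of k] by (auto simp: r_def t_def)
    qed
    finally show ?thesis .
  qed
  show ?thesis
    unfolding sums_def
  proof (rule LIMSEQ_I)
    fix \<epsilon> :: real assume \<epsilon>: "\<epsilon> > 0"
    let ?m = "nrm (dual (c0_copy e)) \<mu>"
    have m: "?m \<ge> 0" by (rule dual_nrm_nonneg[OF n \<mu>])
    have "s \<longlonglongrightarrow> 0" using s by (simp add: null_sequences_def)
    then obtain N where N: "\<And>k. k \<ge> N \<Longrightarrow> norm (s k) < \<epsilon> / (?m + 1)"
      using \<epsilon> m LIMSEQ_D[of s 0 "\<epsilon> / (?m + 1)"] by auto
    have "norm ((\<Sum>k<K. s k * \<mu> (e (unit_vector k))) - \<mu> (e s)) < \<epsilon>" if K: "K \<ge> N" for K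
    proof -
      have "norm ((\<Sum>k<K. s k * \<mu> (e (unit_vector k))) - \<mu> (e s)) \<le> ?m * (\<epsilon> / (?m + 1))"
        unfolding norm_minus_commute[of _ "\<mu> (e s)"] using K N by (intro rest) (auto intro: less_imp_le)
      also have "\<dots> < \<epsilon>" using m \<epsilon> by (simp add: field_simps)
      finally show ?thesis .
    qed
    then show "\<exists>N. \<forall>K\<ge>N. norm ((\<Sum>k<K. s k * \<mu> (e (unit_vector k))) - \<mu> (e s)) < \<epsilon>" by blast
  qed
qed

section \<open>Weakly null sequences of functionals\<close>

text \<open>
  The map \<open>\<phi> \<mapsto> (\<phi> (h k))\<^sub>k\<close> extends \<open>T\<close> to the unit ball of the bidual, with values in \<open>c\<^sub>0\<close> because \<open>h\<close>
  is weakly null. It is continuous from the topology of pointwise convergence to the weak topology,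
  since a functional \<open>\<mu>\<close> on \<open>c\<^sub>0\<close> turns it into the evaluation of \<open>\<phi>\<close> at \<open>\<mu> \<circ> T\<close>. Therefore the image
  of the compact bidual ball is weakly compact, and it contains the image of the unit ball of \<open>X\<close>.
\<close>

lemma weakly_null_functionals_operator:
  fixes X :: "('k::{real_normed_field,euclidean_space}, 'a) nspace"
    and e :: "(nat \<Rightarrow> 'k) \<Rightarrow> 'u"
  assumes X: "normed_space X" and e: "inj e"
    and h: "\<And>k. h k \<in> carr (dual X)" and bounded: "\<And>k. nrm (dual X) (h k) \<le> C"
    and null: "\<And>\<phi>. \<phi> \<in> carr (dual (dual X)) \<Longrightarrow> (\<lambda>k. \<phi> (h k)) \<longlonglongrightarrow> 0"
  shows "weakly_compact_operator X (c0_copy e) (\<lambda>x. e (\<lambda>k. h k x))"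
    (is "weakly_compact_operator X ?Y ?T")
proof -
  note simps = c0_copy_simps[OF e]
  have Y: "normed_space ?Y" by (rule normed_space_c0_copy[OF e])
  have nD: "normed_space (dual X)" using X by (rule normed_space_dual)
  interpret D: normed_space "dual X" by (rule nD)
  have null_X: "(\<lambda>k. h k x) \<in> null_sequences" if x: "x \<in> carr X" for x
    using null[OF evaluation_in_bidual[OF X x]] h by (simp add: null_sequences_def)
  have C: "0 \<le> C" using bounded[of 0] dual_nrm_nonneg[OF X h[of 0]] by linarith
  have op: "operator X ?Y ?T"
    unfolding operator_iff_bounded[OF X Y]
  proof (intro conjI exI[of _ C] ballI)
    show "nrm ?Y (?T x) \<le> C * nrm X x" if x: "x \<in> carr X" for x
    proof (rule c0_copy_nrm_le[OF e])
      show "norm (h k x) \<le> C * nrm X x" for k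
        using dual_apply_le[OF X h x, of k] mult_right_mono[OF bounded normed_space.nrm_nonneg[OF X x], of k]
        by linarith
    qed
  qed (auto simp: simps null_X dual_linear[OF X h])
  let ?\<Psi> = "\<lambda>\<phi>. e (\<lambda>k. \<phi> (h k))"
  let ?B = "subtopology (pointwise_topology (dual X)) (unit_ball (dual (dual X)))"
  have \<phi>D: "\<phi> \<in> carr (dual (dual X))" if "\<phi> \<in> unit_ball (dual (dual X))" for \<phi>
    using that by (simp add: unit_ball_def)
  have null_\<phi>: "(\<lambda>k. \<phi> (h k)) \<in> null_sequences" if "\<phi> \<in> unit_ball (dual (dual X))" for \<phi>
    using null[OF \<phi>D[OF that]] by (simp add: null_sequences_def)
  \<comment> \<open>The partial sums \<open>S N\<close> of \<open>\<Sum>k. \<mu> (e (unit_vector k)) h\<^sub>k\<close> converge in norm to \<open>\<mu> \<circ> T\<close>,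
    because \<open>\<mu>\<close> is in \<open>l\<^sub>1\<close> and the \<open>h k\<close> are bounded. So \<open>\<phi>\<close> may be applied term by term.\<close>
  have swap: "\<phi> (\<lambda>x\<in>carr X. \<mu> (?T x)) = \<mu> (?\<Psi> \<phi>)"
    if \<mu>: "\<mu> \<in> carr (dual ?Y)" and \<phi>: "\<phi> \<in> unit_ball (dual (dual X))" for \<mu> \<phi>
  proof -
    define c where "c k = \<mu> (e (unit_vector k))" for k
    define f where "f = (\<lambda>x\<in>carr X. \<mu> (?T x))"
    define S where "S N = (\<lambda>x\<in>carr X. \<Sum>k<N. c k * h k x)" for N
    have f: "f \<in> carr (dual X)" unfolding f_def by (rule compose_dual[OF X Y op \<mu>])
    have S: "S N \<in> carr (dual X)" and \<phi>S: "\<phi> (S N) = (\<Sum>k<N. c k * \<phi> (h k))" for N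
      using dual_combination[OF X, of "{..<N}" h c] h \<phi>D[OF \<phi>] by (auto simp: S_def)
    have summable: "summable (\<lambda>k. norm (c k))"
      unfolding c_def by (rule c0_copy_functional_summable[OF e \<mu>])
    have error: "norm (\<phi> f - \<phi> (S N)) \<le> C * (\<Sum>k. norm (c (k + N)))" for N
    proof -
      let ?R = "add (dual X) f (smul (dual X) (- 1) (S N))"
      have R: "?R \<in> carr (dual X)" by (intro D.add_closed D.smul_closed f S)
      have "nrm (dual X) ?R \<le> C * (\<Sum>k. norm (c (k + N)))"
      proof (rule dual_nrm_le[OF X])
        fix x assume x: "x \<in> unit_ball X"
        then have x': "x \<in> carr X" by (simp add: unit_ball_def)
        have sums: "(\<lambda>k. h k x * c k) sums f x"
          using c0_copy_functional_sums[OF e \<mu> null_X[OF x']] x' by (simp add: c_def f_def)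
        have hx: "norm (h k x) \<le> C" for k
          using dual_apply_le_unit_ball[OF X h x, of k] bounded[of k] by linarith
        have summable': "summable (\<lambda>k. norm (c (k + N)))"
          by (rule summable_ignore_initial_segment[OF summable])
        have "?R x = f x - (\<Sum>k<N. h k x * c k)"
          using x' by (simp add: dual_simps S_def mult.commute)
        also have "\<dots> = (\<Sum>k. h (k + N) x * c (k + N))"
          using suminf_minus_initial_segment[OF sums_summable[OF sums], of N] sums_unique[OF sums] by simp
        also have "norm \<dots> \<le> (\<Sum>k. C * norm (c (k + N)))"
          by (intro norm_suminf_le summable_mult summable') (auto simp: norm_mult intro!: mult_right_mono hx)
        also have "\<dots> = C * (\<Sum>k. norm (c (k + N)))" by (rule suminf_mult[OF summable'])
        finally show "norm (?R x) \<le> C * (\<Sum>k. norm (c (k + N)))" .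
      qed
      moreover have "norm (\<phi> ?R) \<le> nrm (dual X) ?R"
        using \<phi> R by (simp add: in_dual_unit_ball_iff[OF nD])
      moreover have "\<phi> ?R = \<phi> f - \<phi> (S N)"
        by (simp add: dual_linear[OF nD \<phi>D[OF \<phi>]] f S D.smul_closed)
      ultimately show ?thesis by simp
    qed
    have "(\<lambda>N. C * (\<Sum>k. norm (c (k + N)))) \<longlonglongrightarrow> C * 0"
      by (intro tendsto_intros suminf_exist_split2 summable)
    then have "(\<lambda>N. C * (\<Sum>k. norm (c (k + N)))) \<longlonglongrightarrow> 0" by simp
    from Lim_null_comparison[OF always_eventually[OF allI[OF error]] this]
    have "(\<lambda>N. \<phi> f - \<phi> (S N)) \<longlonglongrightarrow> 0" .
    then have "(\<lambda>N. \<phi> f - (\<phi> f - \<phi> (S N))) \<longlonglongrightarrow> \<phi> f - 0" by (intro tendsto_intros)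
    then have "(\<lambda>N. \<phi> (S N)) \<longlonglongrightarrow> \<phi> f" by simp
    moreover have "(\<lambda>N. \<phi> (S N)) \<longlonglongrightarrow> \<mu> (?\<Psi> \<phi>)"
      using c0_copy_functional_sums[OF e \<mu> null_\<phi>[OF \<phi>]]
      by (simp add: \<phi>S sums_def c_def mult.commute)
    ultimately show ?thesis unfolding f_def by (rule LIMSEQ_unique)
  qed
  have "continuous_map ?B (weak_topology ?Y) ?\<Psi>"
  proof (rule continuous_map_into_weak_topology[OF Y])
    show "?\<Psi> \<in> topspace ?B \<rightarrow> carr ?Y" using null_\<phi> by (auto simp: simps)
    fix \<mu> assume \<mu>: "\<mu> \<in> carr (dual ?Y)"
    show "continuous_map ?B euclidean (\<lambda>\<phi>. \<mu> (?\<Psi> \<phi>))"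
    proof (rule continuous_map_eq)
      show "continuous_map ?B euclidean (\<lambda>\<phi>. \<phi> (\<lambda>x\<in>carr X. \<mu> (?T x)))"
        by (intro continuous_map_from_subtopology continuous_map_product_projection
            compose_dual[OF X Y op \<mu>])
    qed (use swap[OF \<mu>] in simp)
  qed
  moreover have "compactin ?B (unit_ball (dual (dual X)))"
    by (simp add: compactin_subtopology compactin_dual_unit_ball[OF nD])
  ultimately have K: "compactin (weak_topology ?Y) (?\<Psi> ` unit_ball (dual (dual X)))"
    by (rule image_compactin[rotated])
  have "relatively_weakly_compact ?Y (?T ` unit_ball X)"
  proof (rule relatively_weakly_compactI[OF Y _ K])
    fix u v assume u: "u \<in> carr ?Y" and v: "v \<in> carr ?Y" and "u \<noteq> v"
    obtain s where s: "u = e s" using u by (rule in_c0_copyE)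
    obtain t where t: "v = e t" using v by (rule in_c0_copyE)
    have "s \<noteq> t" using \<open>u \<noteq> v\<close> s t by blast
    then obtain n where n: "s n \<noteq> t n" by blast
    let ?coord = "\<lambda>u\<in>carr ?Y. inv e u n"
    have "?coord \<in> carr (dual ?Y)" using c0_copy_coordinate[OF e, of n] by (simp add: unit_ball_def)
    moreover have "?coord u \<noteq> ?coord v" using u v n s t e by simp
    ultimately show "\<exists>f\<in>carr (dual ?Y). f u \<noteq> f v" by blast
  next
    show "?T ` unit_ball X \<subseteq> ?\<Psi> ` unit_ball (dual (dual X))"
    proof
      fix u assume "u \<in> ?T ` unit_ball X"
      then obtain x where x: "x \<in> unit_ball X" "u = ?T x" by blast
      have "u = ?\<Psi> (\<lambda>f\<in>carr (dual X). f x)" using x(2) h by simp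
      then show "u \<in> ?\<Psi> ` unit_ball (dual (dual X))"
        using evaluation_in_bidual_unit_ball[OF X x(1)] by blast
    qed
  qed
  with op show ?thesis by (simp add: weakly_compact_operator_def)
qed

section \<open>The Dunford-Pettis property of order p\<close>

lemma norm_le_tail_norm:
  assumes "1 < p" and summable: "summable (\<lambda>n. norm (a n) powr p)"
  shows "norm (a m) \<le> tail_norm p a m"
proof -
  have "(\<Sum>n<1. norm (a (n + m)) powr p) \<le> (\<Sum>n. norm (a (n + m)) powr p)"
    by (intro sum_le_suminf summable_ignore_initial_segment[OF summable]) auto
  then have "(norm (a m) powr p) powr (1 / p) \<le> tail_norm p a m"
    unfolding tail_norm_def using assms(1) by (intro powr_mono2) auto
  then show ?thesis using assms(1) by (simp add: powr_powr)
qed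

lemma weakly_summable_tendsto_0:
  assumes X: "normed_space X" and p: "1 < p" and x: "x \<in> weakly_summable p X"
    and g: "g \<in> carr (dual X)"
  shows "(\<lambda>n. g (x n)) \<longlonglongrightarrow> 0"
proof -
  have range: "x n \<in> carr X" for n using x by (auto simp: weakly_summable_def)
  obtain r f where f: "f \<in> unit_ball (dual X)" and gf: "g = smul (dual X) (of_real r) f"
    using ex_scaled_unit_ball[OF normed_space_dual[OF X] g] by metis
  have "summable (\<lambda>n. norm (f (x n)) powr p)" using x f by (auto simp: weakly_summable_def)
  then have "(\<lambda>n. norm (f (x n)) powr p) \<longlonglongrightarrow> 0" by (rule summable_LIMSEQ_zero)
  then have "(\<lambda>n. (norm (f (x n)) powr p) powr (1 / p)) \<longlonglongrightarrow> 0 powr (1 / p)"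
    using p by (intro tendsto_powr' tendsto_const) auto
  then have "(\<lambda>n. norm (f (x n))) \<longlonglongrightarrow> 0" using p by (simp add: powr_powr)
  then have "(\<lambda>n. f (x n)) \<longlonglongrightarrow> 0" by (rule tendsto_norm_zero_cancel)
  then have "(\<lambda>n. of_real r * f (x n)) \<longlonglongrightarrow> 0" by (rule tendsto_mult_right_zero)
  then show ?thesis using range by (simp add: gf dual_simps)
qed

text \<open>
  The functionals \<open>h j = f (r j) - g\<close> come from a subsequence \<open>f (r j)\<close> of \<open>K\<close> with weak limit \<open>g\<close>. The
  resulting operator into \<open>c\<^sub>0\<close> is unconditionally p-converging, and the coordinates of \<open>c\<^sub>0\<close> have norm
  at most 1, so \<open>norm (h j (x m))\<close> is at most the m-th tail supremum \<open>s m\<close>, whatever \<open>j\<close> is. At the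
  indices \<open>m = \<nu> (r j)\<close>, where \<open>f (r j)\<close> is large, this is impossible.
\<close>

lemma DPP_imp_weakly_limited:
  fixes X :: "('k::{real_normed_field,euclidean_space}, 'a) nspace"
    and e :: "(nat \<Rightarrow> 'k) \<Rightarrow> 'u"
  assumes X: "banach_space X" and p: "1 < p" and e: "inj e" and DPP: "DPP TYPE('u) p X"
    and K: "relatively_weakly_compact (dual X) K"
  shows "weakly_limited p X K"
proof -
  have nX: "normed_space X" using X by (simp add: banach_space_def)
  interpret D: normed_space "dual X" by (rule normed_space_dual[OF nX])
  have sub: "K \<subseteq> carr (dual X)" using K by (simp add: relatively_weakly_compact_def)
  obtain C where C: "\<And>f. f \<in> K \<Longrightarrow> nrm (dual X) f \<le> C"
    using relatively_weakly_compact_dual_bounded[OF X K] by blast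
  have "(\<lambda>n. SUP f\<in>K. ennreal (norm (f (x n)))) \<longlonglongrightarrow> 0" if x: "x \<in> weakly_summable p X" for x
  proof (rule ccontr)
    assume "\<not> ?thesis"
    then obtain a :: ennreal where "a > 0"
      and a: "\<not> eventually (\<lambda>n. (SUP f\<in>K. ennreal (norm (f (x n)))) < a) sequentially"
      using order_tendstoI[of 0 "\<lambda>n. SUP f\<in>K. ennreal (norm (f (x n)))" sequentially] by auto
    obtain b where b: "0 < b" "b < a" using dense[OF \<open>a > 0\<close>] by blast
    define \<epsilon> where "\<epsilon> = enn2real b"
    have "b < top" by (rule less_le_trans[OF b(2) top_greatest])
    then have b_eq: "b = ennreal \<epsilon>" by (simp add: \<epsilon>_def)
    have \<epsilon>: "\<epsilon> > 0" using b(1) b_eq by (simp add: ennreal_less_zero_iff)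
    let ?I = "{n. \<exists>f\<in>K. \<epsilon> < norm (f (x n))}"
    have "\<exists>n\<ge>m. n \<in> ?I" for m
    proof -
      obtain n where n: "n \<ge> m" "a \<le> (SUP f\<in>K. ennreal (norm (f (x n))))"
        using a by (auto simp: eventually_sequentially not_less)
      then have "ennreal \<epsilon> < (SUP f\<in>K. ennreal (norm (f (x n))))" using b b_eq by simp
      then obtain f where "f \<in> K" "ennreal \<epsilon> < ennreal (norm (f (x n)))"
        unfolding less_SUP_iff by blast
      then show ?thesis using n(1) \<epsilon> by (auto simp: ennreal_less_iff)
    qed
    then have "infinite ?I" unfolding infinite_nat_iff_unbounded_le by blast
    then obtain \<nu> :: "nat \<Rightarrow> nat" where \<nu>: "strict_mono \<nu>" "\<And>k. \<nu> k \<in> ?I"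
      using infinite_enumerate by blast
    then have "\<exists>f. f \<in> K \<and> \<epsilon> < norm (f (x (\<nu> k)))" for k by blast
    then obtain f where f: "\<And>k. f k \<in> K" "\<And>k. \<epsilon> < norm (f k (x (\<nu> k)))" by metis
    obtain r g where r: "strict_mono r" and g: "g \<in> carr (dual X)"
      and lim: "\<And>\<phi>. \<phi> \<in> carr (dual (dual X)) \<Longrightarrow> (\<lambda>j. \<phi> (f (r j))) \<longlonglongrightarrow> \<phi> g"
    proof (rule eberlein_smulian_dual[OF nX K _ f(1)])
      show "nrm (dual X) f \<le> C" if "f \<in> K" for f by (rule C[OF that])
    qed (rule that)
    have fD: "f k \<in> carr (dual X)" for k using f(1) sub by blast
    define h where "h j = add (dual X) (f (r j)) (smul (dual X) (- 1) g)" for j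
    have h: "h j \<in> carr (dual X)" for j
      unfolding h_def by (intro D.add_closed D.smul_closed fD g)
    have hx: "h j y = f (r j) y - g y" if "y \<in> carr X" for j y
      using that by (simp add: h_def dual_simps)
    have "nrm (dual X) (h j) \<le> C + nrm (dual X) g" for j
    proof -
      have "nrm (dual X) (h j) \<le> nrm (dual X) (f (r j)) + nrm (dual X) (smul (dual X) (- 1) g)"
        unfolding h_def by (intro D.nrm_triangle D.smul_closed fD g)
      then show ?thesis using C[OF f(1)[of "r j"]] by (simp add: D.nrm_smul[OF g])
    qed
    moreover have "(\<lambda>j. \<phi> (h j)) \<longlonglongrightarrow> 0" if \<phi>: "\<phi> \<in> carr (dual (dual X))" for \<phi>
    proof -
      have "\<phi> (h j) = \<phi> (f (r j)) - \<phi> g" for j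
        by (simp add: h_def dual_linear[OF D.normed_space_axioms \<phi>] fD g D.smul_closed)
      then show ?thesis using tendsto_diff[OF lim[OF \<phi>] tendsto_const[of "\<phi> g"]] by simp
    qed
    ultimately have "weakly_compact_operator X (c0_copy e) (\<lambda>y. e (\<lambda>j. h j y))"
      by (intro weakly_null_functionals_operator[OF nX e h])
    then have "unconditionally_converging p X (c0_copy e) (\<lambda>y. e (\<lambda>j. h j y))"
      using DPP banach_space_c0_copy[OF e] unfolding DPP_def by blast
    then have y: "(\<lambda>n. e (\<lambda>j. h j (x n))) \<in> unconditionally_summable p (c0_copy e)"
      using x unfolding unconditionally_converging_def by blast
    define s where "s m = (SUP \<mu>\<in>unit_ball (dual (c0_copy e)). tail_norm p (\<lambda>n. \<mu> (e (\<lambda>j. h j (x n)))) m)" for m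
    have s: "s \<longlonglongrightarrow> 0" and ws: "(\<lambda>n. e (\<lambda>j. h j (x n))) \<in> weakly_summable p (c0_copy e)"
      using y by (auto simp: unconditionally_summable_def s_def[abs_def])
    have h_le: "norm (h j (x m)) \<le> s m" for j m
    proof -
      let ?coord = "\<lambda>u\<in>carr (c0_copy e). inv e u j"
      have coord: "?coord \<in> unit_ball (dual (c0_copy e))" by (rule c0_copy_coordinate[OF e])
      have "e (\<lambda>j. h j (x m)) \<in> carr (c0_copy e)" using ws by (auto simp: weakly_summable_def)
      then have "norm (h j (x m)) = norm (?coord (e (\<lambda>j. h j (x m))))" using e by simp
      also have "\<dots> \<le> tail_norm p (\<lambda>n. ?coord (e (\<lambda>j. h j (x n)))) m"
      proof (rule norm_le_tail_norm[OF p])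
        show "summable (\<lambda>n. norm (?coord (e (\<lambda>j. h j (x n)))) powr p)"
          using ws coord unfolding weakly_summable_def by blast
      qed
      also have "\<dots> \<le> s m"
        unfolding s_def by (rule tail_norm_le[OF normed_space_c0_copy[OF e] p ws coord])
      finally show ?thesis .
    qed
    have range: "x n \<in> carr X" for n using x by (auto simp: weakly_summable_def)
    let ?m = "\<lambda>j. \<nu> (r j)"
    have m: "filterlim ?m sequentially sequentially"
      using filterlim_subseq[OF strict_mono_o[OF \<nu>(1) r]] by (simp add: o_def)
    have "\<epsilon> \<le> s (?m j) + norm (g (x (?m j)))" for j
      using f(2)[of "r j"] h_le[of j "?m j"] hx[OF range, of j "?m j"]
        norm_triangle_sub[of "f (r j) (x (?m j))" "g (x (?m j))"] by simp
    moreover have "(\<lambda>j. s (?m j) + norm (g (x (?m j)))) \<longlonglongrightarrow> 0 + 0"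
      using filterlim_compose[OF s m]
        filterlim_compose[OF tendsto_norm_zero[OF weakly_summable_tendsto_0[OF nX p x g]] m]
      by (rule tendsto_add)
    ultimately have "\<epsilon> \<le> 0"
      using LIMSEQ_le_const[of "\<lambda>j. s (?m j) + norm (g (x (?m j)))" 0 \<epsilon>] by auto
    then show False using \<epsilon> by simp
  qed
  with sub C show ?thesis unfolding weakly_limited_def by blast
qed

lemma DPP_iff_weakly_limited:
  fixes X :: "('k::{real_normed_field,euclidean_space}, 'a) nspace"
  assumes X: "banach_space X" and p: "1 < p" and universe: "(UNIV :: (nat \<Rightarrow> 'k) set) \<lesssim> (UNIV :: 'u set)"
  shows "DPP TYPE('u) p X \<longleftrightarrow> (\<forall>K. relatively_weakly_compact (dual X) K \<longrightarrow> weakly_limited p X K)"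
proof
  obtain e :: "(nat \<Rightarrow> 'k) \<Rightarrow> 'u" where "inj e" using universe by (auto simp: lepoll_def)
  then show "\<forall>K. relatively_weakly_compact (dual X) K \<longrightarrow> weakly_limited p X K" if "DPP TYPE('u) p X"
    using DPP_imp_weakly_limited[OF X p _ that] by blast
next
  assume "\<forall>K. relatively_weakly_compact (dual X) K \<longrightarrow> weakly_limited p X K"
  then show "DPP TYPE('u) p X"
    unfolding DPP_def using X p
    by (auto simp: banach_space_def intro!: weakly_limited_imp_unconditionally_converging)
qed

section \<open>Cardinality of the sequence spaces\<close>

text \<open>
  A real is coded by a set of natural numbers, so a sequence of reals is coded by a set of pairs of
  natural numbers, which again amounts to a set of natural numbers.
\<close>

lemma real_sequences_lepoll_reals: "(UNIV :: (nat \<Rightarrow> real) set) \<lesssim> (UNIV :: real set)"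
proof -
  obtain i :: "real \<Rightarrow> nat set" where i: "inj i"
    using nat_sets_eqpoll_reals eqpoll_sym eqpoll_imp_lepoll unfolding lepoll_def by blast
  define code where "code s = {prod_encode (n, m) | n m. m \<in> i (s n)}" for s :: "nat \<Rightarrow> real"
  have "s = t" if "code s = code t" for s t
  proof
    fix n
    have "m \<in> i (s n) \<longleftrightarrow> prod_encode (n, m) \<in> code s" for s :: "nat \<Rightarrow> real" and m
      by (auto simp: code_def)
    then have "i (s n) = i (t n)" using that by blast
    then show "s n = t n" using i by (simp add: inj_eq)
  qed
  then have "inj code" by (rule injI)
  then have "(UNIV :: (nat \<Rightarrow> real) set) \<lesssim> (UNIV :: nat set set)" by (auto simp: lepoll_def)
  then show ?thesis using nat_sets_eqpoll_reals lepoll_trans eqpoll_imp_lepoll by blast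
qed

lemma complex_sequences_lepoll_reals: "(UNIV :: (nat \<Rightarrow> complex) set) \<lesssim> (UNIV :: real set)"
proof -
  define code :: "(nat \<Rightarrow> complex) \<Rightarrow> nat \<Rightarrow> real"
    where "code s n = (if even n then Re (s (n div 2)) else Im (s (n div 2)))" for s n
  have "s = t" if "code s = code t" for s t
  proof
    fix n
    have "code s (2 * n) = code t (2 * n)" "code s (2 * n + 1) = code t (2 * n + 1)"
      using that by simp_all
    then show "s n = t n" by (simp add: code_def complex_eq_iff)
  qed
  then have "inj code" by (rule injI)
  then have "(UNIV :: (nat \<Rightarrow> complex) set) \<lesssim> (UNIV :: (nat \<Rightarrow> real) set)" by (auto simp: lepoll_def)
  then show ?thesis using real_sequences_lepoll_reals by (rule lepoll_trans)
qed

section \<open>The characterization\<close>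

theorem theorem3p1:
  fixes p :: real
    and X :: "(real, 'a) nspace"
    and Z :: "(complex, 'b) nspace"
  assumes p: "1 < p"
    and universe: "(UNIV :: real set) \<lesssim> (UNIV :: 'u set)"
  shows "(banach_space X \<longrightarrow>
           (DPP TYPE('u) p X \<longleftrightarrow>
             (\<forall>K. relatively_weakly_compact (dual X) K \<longrightarrow> weakly_limited p X K))) \<and>
         (banach_space Z \<longrightarrow>
           (DPP TYPE('u) p Z \<longleftrightarrow>
             (\<forall>K. relatively_weakly_compact (dual Z) K \<longrightarrow> weakly_limited p Z K)))"
  using DPP_iff_weakly_limited[OF _ p lepoll_trans[OF real_sequences_lepoll_reals universe]]
    DPP_iff_weakly_limited[OF _ p lepoll_trans[OF complex_sequences_lepoll_reals universe]]
  by blast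

end
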